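(* Let $m\geq1$ and $n>2m$. Every LVM manifold $N_\Lambda$ corresponding to an admissible configuration $\Lambda=(\Lambda_1,\dots,\Lambda_n)$ of vectors in $\mathbb{C}^m$ is a small deformation of (the total space of) a generalized Calabi–Eckmann fibration.
   Context: $\mathcal{H}(\cdot)$ denotes the convex hull in $\mathbb{C}^m\cong\mathbb{R}^{2m}$. The configuration $\Lambda$ is admissible if (Siegel) $0\in\mathcal{H}(\Lambda_1,\dots,\Lambda_n)$ and (weak hyperbolicity) $0\notin\mathcal{H}(\Lambda_{i_1},\dots,\Lambda_{i_{2m}})$ for all $1\le i_1<\dots<i_{2m}\le n$. Admissibility is an open condition in $(\mathbb{C}^m)^n$. LVM manifold: let $\mathcal{S}=\{z\in\mathbb{C}^n : 0\in\mathcal{H}((\Lambda_i)_{i: z_i\ne0})\}$ and $\mathcal{V}\subset\mathbb{P}^{n-1}_{\mathbb{C}}$ its image. $N_\Lambda$ is the compact complex manifold of dimension $n-m-1$ obtained as the quotient of $\mathcal{V}$ by the holomorphic $\mathbb{C}^m$-action $T\cdot[z_i]_i=[z_i\exp\langle\Lambda_i,T\rangle]_i$, where $\langle Z,W\rangle=\sum_jZ_jW_j$. Condition (K): an admissible configuration satisfies (K) if the $\mathbb{Q}$-vector space of rational solutions $(s_1,\dots,s_n)\in\mathbb{Q}^n$ of the system $\sum_i s_i\Lambda_i=0$, $\sum_i s_i=0$ has maximal dimension $n-2m-1$. Generalized Calabi–Eckmann fibration: if $\Lambda$ satisfies (K), the $m$ commuting vector fields $\sum_{j=1}^n\mathrm{Re}(\lambda_j^i)z_j\,\partial/\partial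 z_j$, $1\le i\le m$ (where $\Lambda_j=(\lambda_j^1,\dots,\lambda_j^m)$), induce on $N_\Lambda$ a holomorphic foliation whose leaves are compact complex tori of dimension $m$. The quotient is a projective toric variety $X$ of dimension $n-2m-1$ with at most quotient singularities, and the projection $N_\Lambda\to X$ is a holomorphic principal Seifert bundle; this projection is what is called a generalized Calabi–Eckmann fibration. Small deformation: in the sense of small perturbations of the configuration, i.e. in every neighborhood of $\Lambda$ in $(\mathbb{C}^m)^n$ there is an admissible configuration $\Lambda'$ satisfying (K), so that $N_\Lambda$ and $N_{\Lambda'}$ are fibres of the holomorphic family of LVM manifolds parametrized by a small connected neighborhood of $\Lambda$. *)

theory Defs
  imports "HOL-Analysis.Analysis"
begin

section \<open>Complex structures and holomorphic functions of several variables\<close>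

class complex_structure = real_normed_vector +
  fixes imult :: "'a \<Rightarrow> 'a"
  assumes imult_add: "imult (x + y) = imult x + imult y"
    and imult_scaleR: "imult (r *\<^sub>R x) = r *\<^sub>R imult x"
    and imult_bounded: "\<exists>K. \<forall>x. norm (imult x) \<le> norm x * K"
    and imult_imult: "imult (imult x) = - x"

lemma imult_bounded_linear: "bounded_linear (imult :: 'a::complex_structure \<Rightarrow> 'a)"
  using imult_bounded by (blast intro: bounded_linear_intro imult_add imult_scaleR)

instantiation complex :: complex_structure
begin
definition imult_complex :: "complex \<Rightarrow> complex" where
  "imult_complex z = \<i> * z"
instance
proof
  have "norm (imult x) \<le> norm x * 1" for x :: complex
    by (simp add: imult_complex_def norm_mult)
  then show "\<exists>K. \<forall>x::complex. norm (imult x) \<le> norm x * K"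
    by blast
qed (simp_all add: imult_complex_def algebra_simps)
end

instantiation prod :: (complex_structure, complex_structure) complex_structure
begin
definition imult_prod :: "'a \<times> 'b \<Rightarrow> 'a \<times> 'b" where
  "imult_prod p = (imult (fst p), imult (snd p))"
instance
proof
  have "bounded_linear (\<lambda>p::'a \<times> 'b. (imult (fst p), imult (snd p)))"
    by (intro bounded_linear_Pair bounded_linear_compose [OF imult_bounded_linear]
        bounded_linear_fst bounded_linear_snd)
  then show "\<exists>K. \<forall>p::'a \<times> 'b. norm (imult p) \<le> norm p * K"
    unfolding imult_prod_def by (blast dest: bounded_linear.bounded)
qed (simp_all add: imult_prod_def imult_add imult_scaleR imult_imult prod_eq_iff)
end

instantiation vec :: (complex_structure, finite) complex_structure
begin
definition imult_vec :: "'a ^ 'b \<Rightarrow> 'a ^ 'b" where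
  "imult_vec v = (\<chi> i. imult (v $ i))"
instance
proof
  obtain K :: real where K: "\<And>x::'a. norm (imult x) \<le> norm x * K"
    using imult_bounded by blast
  have "norm (imult x) \<le> norm x * (real CARD('b) * \<bar>K\<bar>)" for x :: "'a ^ 'b"
  proof -
    have "norm (imult x) \<le> (\<Sum>i\<in>UNIV. norm (imult x $ i))"
      unfolding norm_vec_def by (rule L2_set_le_sum) simp
    also have "\<dots> \<le> (\<Sum>i\<in>(UNIV::'b set). norm x * \<bar>K\<bar>)"
    proof (rule sum_mono)
      fix i :: 'b
      have "norm (imult x $ i) \<le> norm (x $ i) * K"
        by (simp add: imult_vec_def K)
      also have "\<dots> \<le> norm (x $ i) * \<bar>K\<bar>"
        by (intro mult_left_mono) auto
      also have "\<dots> \<le> norm x * \<bar>K\<bar>"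
        by (intro mult_right_mono Finite_Cartesian_Product.norm_nth_le) auto
      finally show "norm (imult x $ i) \<le> norm x * \<bar>K\<bar>" .
    qed
    finally show ?thesis
      by (simp add: mult_ac)
  qed
  then show "\<exists>K. \<forall>x::'a ^ 'b. norm (imult x) \<le> norm x * K"
    by blast
qed (simp_all add: imult_vec_def imult_add imult_scaleR imult_imult vec_eq_iff)
end

definition holomorphic_several ::
    "'a::complex_structure set \<Rightarrow> ('a \<Rightarrow> complex) \<Rightarrow> bool" where
  "holomorphic_several U f \<longleftrightarrow>
     (\<forall>x\<in>U. \<exists>D. (f has_derivative D) (at x) \<and> (\<forall>v. D (imult v) = \<i> * D v))"


section \<open>Spaces with a structure sheaf of holomorphic functions\<close>

text \<open>
  Complex manifolds (and the possibly singular leaf spaces below) are represented as topological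
  spaces together with their sheaf of holomorphic functions: \<open>cs_hol X U f\<close> says that \<open>f\<close> is
  holomorphic on \<open>U\<close>, and it is only used for \<open>U\<close> open in \<open>cs_top X\<close>.  The values of \<open>f\<close> outside
  \<open>U\<close> are irrelevant.
\<close>

record 'a cspace =
  cs_top :: "'a topology"
  cs_hol :: "'a set \<Rightarrow> ('a \<Rightarrow> complex) \<Rightarrow> bool"

abbreviation cs_points :: "'a cspace \<Rightarrow> 'a set" where
  "cs_points X \<equiv> topspace (cs_top X)"

definition open_cspace :: "'a::complex_structure set \<Rightarrow> 'a cspace" where
  "open_cspace B = \<lparr>cs_top = top_of_set B, cs_hol = holomorphic_several\<rparr>"

definition cs_restrict :: "'a cspace \<Rightarrow> 'a set \<Rightarrow> 'a cspace" where
  "cs_restrict X A = \<lparr>cs_top = subtopology (cs_top X) A, cs_hol = cs_hol X\<rparr>"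

text \<open>
  The quotient of \<open>X\<close> by the fibres of \<open>q\<close>: quotient topology, and a function is holomorphic
  iff its pullback along \<open>q\<close> is.
\<close>

definition cs_quotient :: "'a cspace \<Rightarrow> ('a \<Rightarrow> 'b) \<Rightarrow> 'b cspace" where
  "cs_quotient X q =
     \<lparr>cs_top = topology (\<lambda>U. U \<subseteq> q ` cs_points X \<and> openin (cs_top X) {x \<in> cs_points X. q x \<in> U}),
      cs_hol = (\<lambda>U f. cs_hol X {x \<in> cs_points X. q x \<in> U} (f \<circ> q))\<rparr>"

lemma openin_cs_quotient:
  "openin (cs_top (cs_quotient X q)) U \<longleftrightarrow>
     U \<subseteq> q ` cs_points X \<and> openin (cs_top X) {x \<in> cs_points X. q x \<in> U}"
proof -
  have "istopology (\<lambda>U. U \<subseteq> q ` cs_points X \<and> openin (cs_top X) {x \<in> cs_points X. q x \<in> U})"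
    unfolding istopology_def
  proof (intro conjI allI impI; (elim conjE)?)
    fix S T
    assume "openin (cs_top X) {x \<in> cs_points X. q x \<in> S}"
      and "openin (cs_top X) {x \<in> cs_points X. q x \<in> T}"
    then have "openin (cs_top X) ({x \<in> cs_points X. q x \<in> S} \<inter> {x \<in> cs_points X. q x \<in> T})"
      by (rule openin_Int)
    then show "openin (cs_top X) {x \<in> cs_points X. q x \<in> S \<inter> T}"
      by (rule back_subst [where P = "openin (cs_top X)"]) auto
  next
    fix \<K>
    assume *: "\<forall>K\<in>\<K>. K \<subseteq> q ` cs_points X \<and> openin (cs_top X) {x \<in> cs_points X. q x \<in> K}"
    then have "openin (cs_top X) (\<Union>K\<in>\<K>. {x \<in> cs_points X. q x \<in> K})"
      by blast
    then show "openin (cs_top X) {x \<in> cs_points X. q x \<in> \<Union>\<K>}"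
      by (rule back_subst [where P = "openin (cs_top X)"]) auto
    show "\<Union>\<K> \<subseteq> q ` cs_points X"
      using * by blast
  qed auto
  then show ?thesis
    by (simp add: cs_quotient_def topology_inverse')
qed

lemma quotient_map_cs_quotient: "quotient_map (cs_top X) (cs_top (cs_quotient X q)) q"
proof -
  have "{x \<in> cs_points X. q x \<in> q ` cs_points X} = cs_points X"
    by auto
  then have "openin (cs_top (cs_quotient X q)) (q ` cs_points X)"
    by (simp add: openin_cs_quotient)
  moreover have "cs_points (cs_quotient X q) \<subseteq> q ` cs_points X"
    using openin_topspace [of "cs_top (cs_quotient X q)"] unfolding openin_cs_quotient by (rule conjunct1)
  ultimately have "cs_points (cs_quotient X q) = q ` cs_points X"
    by (simp add: openin_subset subset_antisym)
  then show ?thesis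
    by (auto simp: quotient_map_def openin_cs_quotient)
qed

text \<open>
  Since \<open>\<phi>\<close> is injective on the points of \<open>X\<close>, every function on \<open>X\<close> is a pullback \<open>f \<circ> \<phi>\<close>;
  so the equivalence below makes both \<open>\<phi>\<close> and its inverse holomorphic.
\<close>

definition biholomorphic_map :: "'a cspace \<Rightarrow> 'b cspace \<Rightarrow> ('a \<Rightarrow> 'b) \<Rightarrow> bool" where
  "biholomorphic_map X Y \<phi> \<longleftrightarrow>
     homeomorphic_map (cs_top X) (cs_top Y) \<phi> \<and>
     (\<forall>V f. openin (cs_top Y) V \<longrightarrow>
        (cs_hol Y V f \<longleftrightarrow> cs_hol X {x \<in> cs_points X. \<phi> x \<in> V} (f \<circ> \<phi>)))"

definition biholomorphic :: "'a cspace \<Rightarrow> 'b cspace \<Rightarrow> bool" where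
  "biholomorphic X Y \<longleftrightarrow> (\<exists>\<phi>. biholomorphic_map X Y \<phi>)"


section \<open>Holomorphic families of compact complex manifolds\<close>

text \<open>
  \<open>\<pi>\<close> makes \<open>E\<close> a holomorphic family over the open set \<open>W\<close> in the sense of Kodaira and Spencer:
  \<open>E\<close> is a complex manifold and \<open>\<pi>\<close> is a proper surjective holomorphic submersion whose fibres
  have dimension \<open>CARD('d)\<close>.  The submersion property is expressed by charts of \<open>E\<close> with
  values in \<open>W \<times> \<complex>\<^sup>d\<close> in which \<open>\<pi>\<close> is the first projection.
\<close>

definition holomorphic_family ::
    "'d::finite itself \<Rightarrow> 'e cspace \<Rightarrow> ('e \<Rightarrow> 'b::complex_structure) \<Rightarrow> 'b set \<Rightarrow> bool" where
  "holomorphic_family (_ :: 'd itself) E \<pi> W \<longleftrightarrow>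
     open W \<and>
     Hausdorff_space (cs_top E) \<and> second_countable (cs_top E) \<and>
     proper_map (cs_top E) (top_of_set W) \<pi> \<and> \<pi> ` cs_points E = W \<and>
     (\<forall>x \<in> cs_points E. \<exists>A (B :: ('b \<times> (complex ^ 'd)) set) \<phi>.
        openin (cs_top E) A \<and> x \<in> A \<and> open B \<and>
        biholomorphic_map (cs_restrict E A) (open_cspace B) \<phi> \<and>
        (\<forall>y\<in>A. fst (\<phi> y) = \<pi> y))"

text \<open>
  The fibre over \<open>t\<close> as a complex subspace: its holomorphic functions are the local
  restrictions of holomorphic functions on \<open>E\<close>.
\<close>

definition cs_fibre :: "'e cspace \<Rightarrow> ('e \<Rightarrow> 'b) \<Rightarrow> 'b \<Rightarrow> 'e cspace" where
  "cs_fibre E \<pi> t =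
     \<lparr>cs_top = subtopology (cs_top E) {x \<in> cs_points E. \<pi> x = t},
      cs_hol = (\<lambda>U f. \<forall>x\<in>U. \<exists>A g. openin (cs_top E) A \<and> x \<in> A \<and> cs_hol E A g \<and>
                  (\<forall>y \<in> A \<inter> U. g y = f y))\<rparr>"


section \<open>Admissible configurations and condition (K)\<close>

definition siegel :: "(complex ^ 'm) ^ 'n \<Rightarrow> bool" where
  "siegel \<Lambda> \<longleftrightarrow> 0 \<in> convex hull (range (\<lambda>i. \<Lambda> $ i))"

definition weakly_hyperbolic :: "(complex ^ 'm) ^ 'n \<Rightarrow> bool" where
  "weakly_hyperbolic \<Lambda> \<longleftrightarrow>
     (\<forall>I :: 'n set. card I = 2 * CARD('m) \<longrightarrow> 0 \<notin> convex hull ((\<lambda>i. \<Lambda> $ i) ` I))"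

definition admissible :: "(complex ^ 'm) ^ 'n \<Rightarrow> bool" where
  "admissible \<Lambda> \<longleftrightarrow> siegel \<Lambda> \<and> weakly_hyperbolic \<Lambda>"

definition rational_relations :: "(complex ^ 'm) ^ 'n \<Rightarrow> (rat ^ 'n) set" where
  "rational_relations \<Lambda> =
     {s. (\<Sum>i\<in>UNIV. real_of_rat (s $ i) *\<^sub>R (\<Lambda> $ i)) = 0 \<and> (\<Sum>i\<in>UNIV. s $ i) = 0}"

definition condition_K :: "(complex ^ 'm) ^ 'n \<Rightarrow> bool" where
  "condition_K \<Lambda> \<longleftrightarrow> vec.dim (rational_relations \<Lambda>) = CARD('n) - 2 * CARD('m) - 1"


section \<open>LVM manifolds\<close>

definition siegel_points :: "(complex ^ 'm) ^ 'n \<Rightarrow> (complex ^ 'n) set" where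
  "siegel_points \<Lambda> = {z. 0 \<in> convex hull ((\<lambda>i. \<Lambda> $ i) ` {i. z $ i \<noteq> 0})}"

definition diag_act ::
    "(complex ^ 'm) ^ 'n \<Rightarrow> complex ^ 'm \<Rightarrow> complex ^ 'n \<Rightarrow> complex ^ 'n" where
  "diag_act \<Lambda> T z = (\<chi> i. z $ i * exp (\<Sum>j\<in>UNIV. \<Lambda> $ i $ j * T $ j))"

text \<open>
  A point of projective space is the line through \<open>z\<close> with the origin removed.  A linear map
  acts on such lines by taking images.
\<close>

definition proj_point :: "complex ^ 'n \<Rightarrow> (complex ^ 'n) set" where
  "proj_point z = {c *s z | c. c \<noteq> 0}"

definition projective_space :: "(complex ^ 'n) set cspace" where
  "projective_space = cs_quotient (open_cspace (- {0})) proj_point"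

definition V_space :: "(complex ^ 'm) ^ 'n \<Rightarrow> (complex ^ 'n) set cspace" where
  "V_space \<Lambda> = cs_restrict projective_space (proj_point ` siegel_points \<Lambda>)"

definition lvm_orbit ::
    "(complex ^ 'm) ^ 'n \<Rightarrow> (complex ^ 'n) set \<Rightarrow> (complex ^ 'n) set set" where
  "lvm_orbit \<Lambda> p = {diag_act \<Lambda> T ` p | T. True}"

definition LVM :: "(complex ^ 'm) ^ 'n \<Rightarrow> (complex ^ 'n) set set cspace" where
  "LVM \<Lambda> = cs_quotient (V_space \<Lambda>) (lvm_orbit \<Lambda>)"

text \<open>
  The LVM manifolds over a set \<open>W\<close> of configurations, glued into one space: the quotient of
  \<open>{(\<Lambda>, z). \<Lambda> \<in> W \<and> z \<in> siegel_points \<Lambda>}\<close> by the fibrewise action.  Its projection to \<open>W\<close> is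
  \<open>fst\<close>, and its points over \<open>\<Lambda>\<close> are the pairs of \<open>\<Lambda>\<close> with a point of \<open>LVM \<Lambda>\<close>.
\<close>

definition LVM_family ::
    "((complex ^ 'm) ^ 'n) set \<Rightarrow> (((complex ^ 'm) ^ 'n) \<times> (complex ^ 'n) set set) cspace" where
  "LVM_family W =
     cs_quotient (open_cspace {(\<Lambda>, z). \<Lambda> \<in> W \<and> z \<in> siegel_points \<Lambda>})
       (\<lambda>(\<Lambda>, z). (\<Lambda>, lvm_orbit \<Lambda> (proj_point z)))"


section \<open>Generalized Calabi--Eckmann fibrations\<close>

definition CE_field :: "(complex ^ 'm) ^ 'n \<Rightarrow> 'm \<Rightarrow> complex ^ 'n \<Rightarrow> complex ^ 'n" where
  "CE_field \<Lambda> i z = (\<chi> j. complex_of_real (Re (\<Lambda> $ j $ i)) * z $ j)"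

definition Re_config :: "(complex ^ 'm) ^ 'n \<Rightarrow> (complex ^ 'm) ^ 'n" where
  "Re_config \<Lambda> = (\<chi> j i. complex_of_real (Re (\<Lambda> $ j $ i)))"

text \<open>
  The commuting fields \<open>CE_field \<Lambda> i\<close> generate the action \<open>diag_act (Re_config \<Lambda>)\<close>, whose
  \<open>i\<close>-th parameter is the complex time of the \<open>i\<close>-th field.
\<close>

lemma diag_act_Re_config_zero: "diag_act (Re_config \<Lambda>) 0 z = z"
  by (simp add: diag_act_def vec_eq_iff)

lemma diag_act_Re_config_flow:
  "((\<lambda>t. diag_act (Re_config \<Lambda>) (T + t *s axis i 1) z $ j) has_field_derivative
      CE_field \<Lambda> i (diag_act (Re_config \<Lambda>) (T + t *s axis i 1) z) $ j) (at t)"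
proof -
  have *: "(\<Sum>k\<in>UNIV. Re_config \<Lambda> $ j $ k * (T + s *s axis i 1) $ k) =
      (\<Sum>k\<in>UNIV. Re_config \<Lambda> $ j $ k * T $ k) + complex_of_real (Re (\<Lambda> $ j $ i)) * s" for s
  proof -
    have "(\<Sum>k\<in>UNIV. Re_config \<Lambda> $ j $ k * (s * axis i 1 $ k)) =
        (\<Sum>k\<in>UNIV. if k = i then Re_config \<Lambda> $ j $ k * s else 0)"
      by (rule sum.cong) (auto simp: axis_def)
    then show ?thesis
      by (simp add: ring_distribs sum.distrib Re_config_def)
  qed
  show ?thesis
    unfolding diag_act_def vec_lambda_beta * CE_field_def
    by (auto intro!: derivative_eq_intros)
qed

text \<open>
  The leaf through a point \<open>x\<close> of \<open>LVM \<Lambda>\<close>, and the space of leaves.  The points \<open>x\<close> are sets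
  of lines, hence the iterated image.
\<close>

definition CE_leaf ::
    "(complex ^ 'm) ^ 'n \<Rightarrow> (complex ^ 'n) set set \<Rightarrow> (complex ^ 'n) set set set" where
  "CE_leaf \<Lambda> x = {(\<lambda>p. diag_act (Re_config \<Lambda>) T ` p) ` x | T. True}"

definition CE_leaf_space :: "(complex ^ 'm) ^ 'n \<Rightarrow> (complex ^ 'n) set set set cspace" where
  "CE_leaf_space \<Lambda> = cs_quotient (LVM \<Lambda>) (CE_leaf \<Lambda>)"

text \<open>
  \<open>p : N \<rightarrow> X\<close> is the generalized Calabi--Eckmann fibration determined by \<open>\<Lambda>\<close>: the projection of
  \<open>LVM \<Lambda>\<close> to its leaf space, for an admissible \<open>\<Lambda>\<close> satisfying (K).
\<close>

definition generalized_CE_fibration ::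
    "(complex ^ 'm) ^ 'n \<Rightarrow> (complex ^ 'n) set set cspace \<Rightarrow> (complex ^ 'n) set set set cspace \<Rightarrow>
     ((complex ^ 'n) set set \<Rightarrow> (complex ^ 'n) set set set) \<Rightarrow> bool" where
  "generalized_CE_fibration \<Lambda> N X p \<longleftrightarrow>
     admissible \<Lambda> \<and> condition_K \<Lambda> \<and> N = LVM \<Lambda> \<and> X = CE_leaf_space \<Lambda> \<and> p = CE_leaf \<Lambda>"

end

theory Submission
  imports Defs
begin

text \<open>
  Weak hyperbolicity and Caratheodory's theorem show that \<open>0\<close> is interior to every hull that
  contains it: in each direction \<open>T\<close> some weight \<open>Re \<langle>\<Lambda>\<^sub>i, T\<rangle>\<close> is at least \<open>r \<bar>T\<bar>\<close>. Hence on
  a small ball \<open>W\<close> around \<open>\<Lambda>\<close> all configurations are admissible, with the same index sets whose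
  hull contains \<open>0\<close> and a common \<open>r\<close>, and the total space to be divided is a product \<open>W \<times> S\<close>.
  The bound makes the action of \<open>\<complex>\<^sup>m \<times> \<complex>\<close> on \<open>W \<times> S\<close> proper, and free up to the periods of
  the exponential; so the quotient is Hausdorff, and slices on which \<open>m + 1\<close> suitable coordinates
  are constant give charts. The retraction onto a slice solves a linear system (Cramer's rule)
  for logarithms of coordinate quotients, hence is holomorphic. The family is proper over \<open>W\<close>
  because every orbit contains a vector of minimal norm (Kempf--Ness), and these form a compact
  set over each compact subset of \<open>W\<close>. Finally, a configuration in \<open>W\<close> with rational real and
  imaginary parts satisfies (K): the \<open>2m + 1\<close> rational equations are independent since a dependency
  would give a nonzero direction in which all weights have the same real part.
\<close>

section \<open>Weights and index sets of an admissible configuration\<close>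

text \<open>Forming projective space first and dividing by C^m afterwards would mean handling two
  quotients. A logarithmic scalar is therefore added to the group, and one quotient of an open set
  of vectors is studied. The price is the period 2 pi i of the exponential: the action is free only
  modulo this period, and the scalar parameter is normalised to have imaginary part at most pi in
  absolute value. Properness takes the form of a statement on sequences, so that the Hausdorff
  property and the local injectivity of slices come from the same compactness argument. The
  configuration is itself a coordinate of the total space, and everything must depend
  holomorphically on it; hence slices freeze coordinates of the vector only, and the group element
  leading to the slice is given by determinants. Identifying a fibre with the manifold built from
  its own configuration needs one more argument, because functions on a fibre are by definition
  local restrictions: they are extended over a chart constantly in the base direction.\<close>

definition weight :: "(complex ^ 'm) ^ 'n \<Rightarrow> 'n \<Rightarrow> complex ^ 'm \<Rightarrow> complex" where
  "weight L i T = (\<Sum>j\<in>UNIV. L $ i $ j * T $ j)"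

text \<open>The pairing in \<open>weight\<close> is complex bilinear, whereas hulls are separated by
  the real inner product. Conjugation is the norm-preserving bijection that translates between the
  two.\<close>

definition cnj_vec :: "complex ^ 'm \<Rightarrow> complex ^ 'm" where
  "cnj_vec T = (\<chi> j. cnj (T $ j))"

lemma cnj_vec_cnj_vec [simp]: "cnj_vec (cnj_vec T) = T"
  by (simp add: cnj_vec_def)

lemma norm_cnj_vec [simp]: "norm (cnj_vec T) = norm T"
  by (simp add: cnj_vec_def norm_vec_def)

lemma Re_weight: "Re (weight L i T) = cnj_vec T \<bullet> L $ i"
  by (simp add: weight_def cnj_vec_def inner_vec_def inner_complex_def mult.commute)

lemma weight_add: "weight L i (S + T) = weight L i S + weight L i T"
  by (simp add: weight_def ring_distribs sum.distrib)

lemma weight_minus: "weight L i (- T) = - weight L i T"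
  by (simp add: weight_def sum_negf)

lemma weight_zero [simp]: "weight L i 0 = 0"
  by (simp add: weight_def)

text \<open>
  If no vector with index in \<open>I\<close> lay strictly on the side of \<open>a\<close>, then \<open>0\<close> would be in the hull
  of those orthogonal to \<open>a\<close>, hence in the hull of at most \<open>2m\<close> of them by Caratheodory's theorem.
\<close>

lemma weakly_hyperbolic_direction:
  fixes L :: "(complex ^ 'm) ^ 'n"
  assumes wh: "weakly_hyperbolic L" and n: "2 * CARD('m) \<le> CARD('n)"
    and hull: "0 \<in> convex hull ((\<lambda>i. L $ i) ` I)" and "a \<noteq> 0"
  shows "\<exists>i\<in>I. a \<bullet> L $ i > 0"
proof (rule ccontr)
  assume "\<not> ?thesis"
  then have le: "a \<bullet> x \<le> 0" if "x \<in> (\<lambda>i. L $ i) ` I" for x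
    using that by force
  let ?X = "(\<lambda>i. L $ i) ` I"
  define P where "P = {x \<in> ?X. a \<bullet> x = 0}"
  obtain u where u: "\<And>x. x \<in> ?X \<Longrightarrow> 0 \<le> u x" "sum u ?X = 1" "(\<Sum>x\<in>?X. u x *\<^sub>R x) = 0"
    using hull by (auto simp: convex_hull_finite)
  have "(\<Sum>x\<in>?X. - (u x * (a \<bullet> x))) = - (a \<bullet> (\<Sum>x\<in>?X. u x *\<^sub>R x))"
    by (simp add: inner_sum_right sum_negf)
  then have "(\<Sum>x\<in>?X. - (u x * (a \<bullet> x))) = 0"
    using u(3) by simp
  moreover have "0 \<le> - (u x * (a \<bullet> x))" if "x \<in> ?X" for x
    using u(1) le that by (simp add: mult_nonneg_nonpos)
  ultimately have "- (u x * (a \<bullet> x)) = 0" if "x \<in> ?X" for x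
    using that by (subst (asm) sum_nonneg_eq_0_iff) auto
  then have u0: "u x = 0" if "x \<in> ?X - P" for x
    using that by (auto simp: P_def)
  have P: "P \<subseteq> ?X" "finite P"
    by (auto simp: P_def)
  have "sum u P = 1" "(\<Sum>x\<in>P. u x *\<^sub>R x) = 0"
    using u(2,3) sum.mono_neutral_right[of ?X P u] sum.mono_neutral_right[of ?X P "\<lambda>x. u x *\<^sub>R x"] P u0
    by auto
  then have "0 \<in> convex hull P"
    using u(1) P by (auto simp: convex_hull_finite intro!: exI[of _ u])
  then obtain S where S: "finite S" "S \<subseteq> P" "int (card S) \<le> aff_dim P + 1" "0 \<in> convex hull S"
    unfolding caratheodory_aff_dim[of P] by auto
  \<comment> \<open>A real hyperplane of C^m has dimension 2m - 1, so Caratheodory's bound becomes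
    2m, the size that weak hyperbolicity excludes.\<close>
  have "aff_dim P \<le> aff_dim {x. a \<bullet> x = 0}"
    by (rule aff_dim_subset) (auto simp: P_def)
  also have "\<dots> = int (CARD('m) * 2) - 1"
    using \<open>a \<noteq> 0\<close> by simp
  finally have cS: "card S \<le> 2 * CARD('m)"
    using S(3) by simp
  \<comment> \<open>Several indices may carry the same vector, so one index is chosen for each point
    of \<open>S\<close>. The resulting set is then padded to exactly 2m indices, for which 2m \<le>
    n is required.\<close>
  obtain J where J: "J \<subseteq> I" "inj_on (\<lambda>i. L $ i) J" "S = (\<lambda>i. L $ i) ` J"
    using S(2) P(1) subset_image_inj[of S "\<lambda>i. L $ i" I] by blast
  have "card J \<le> 2 * CARD('m)"
    using cS J by (simp add: card_image)
  then obtain J' where J': "J \<subseteq> J'" "card J' = 2 * CARD('m)"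
    using n exists_subset_between[of J "2 * CARD('m)" UNIV] by auto
  have "0 \<in> convex hull ((\<lambda>i. L $ i) ` J')"
    using S(4) J(3) J'(1) hull_mono[of "(\<lambda>i. L $ i) ` J" "(\<lambda>i. L $ i) ` J'"] by (auto simp: image_mono)
  then show False
    using wh J'(2) by (auto simp: weakly_hyperbolic_def)
qed

lemma hull_separation:
  fixes L :: "(complex ^ 'm) ^ 'n"
  assumes "0 \<notin> convex hull ((\<lambda>i. L $ i) ` I)"
  obtains a where "a \<noteq> 0" "norm a = 1" "\<And>i. i \<in> I \<Longrightarrow> a \<bullet> L $ i > 0"
proof -
  have "closed (convex hull ((\<lambda>i. L $ i) ` I))"
    by (intro compact_imp_closed compact_convex_hull finite_imp_compact) auto
  then obtain a b where a: "a \<noteq> 0" "0 < b" "\<And>x. x \<in> convex hull ((\<lambda>i. L $ i) ` I) \<Longrightarrow> a \<bullet> x > b"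
    using separating_hyperplane_closed_0[OF convex_convex_hull _ assms] by blast
  have "a \<bullet> L $ i > 0" if "i \<in> I" for i
    using a(2) a(3)[of "L $ i"] that hull_inc[of "L $ i" "(\<lambda>i. L $ i) ` I"] by fastforce
  then show thesis
    using a(1) by (intro that[of "sgn a"]) (auto simp: sgn_div_norm norm_sgn)
qed

text \<open>The maximum over \<open>I\<close> is replaced by a sum of positive parts, which is
  visibly continuous. It attains a positive minimum on the unit sphere, and some summand is at least
  the average.\<close>

lemma direction_uniform:
  fixes L :: "(complex ^ 'm) ^ 'n"
  assumes "\<And>a. a \<noteq> 0 \<Longrightarrow> \<exists>i\<in>I. a \<bullet> L $ i > 0"
  obtains r where "r > 0" "\<And>a. norm a = 1 \<Longrightarrow> \<exists>i\<in>I. a \<bullet> L $ i \<ge> r"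
proof -
  define f where "f a = (\<Sum>i\<in>I. max 0 (a \<bullet> L $ i))" for a
  have "continuous_on (sphere 0 1) f"
    unfolding f_def by (intro continuous_intros)
  moreover have "sphere (0::complex^'m) 1 \<noteq> {}"
    by simp
  ultimately obtain a0 where a0: "a0 \<in> sphere 0 1" "\<And>a. a \<in> sphere 0 1 \<Longrightarrow> f a0 \<le> f a"
    using continuous_attains_inf[of "sphere 0 1" f] by auto
  obtain i0 where i0: "i0 \<in> I" "a0 \<bullet> L $ i0 > 0"
    using assms[of a0] a0(1) by force
  have "f a0 \<ge> max 0 (a0 \<bullet> L $ i0)"
    unfolding f_def using i0(1) by (intro member_le_sum) auto
  then have f0: "f a0 > 0"
    using i0(2) by linarith
  have I: "card I > 0"
    using i0(1) by (auto simp: card_gt_0_iff)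
  show thesis
  proof
    show "f a0 / card I > 0"
      using f0 I by simp
    fix a :: "complex^'m" assume a: "norm a = 1"
    show "\<exists>i\<in>I. a \<bullet> L $ i \<ge> f a0 / card I"
    proof (rule ccontr)
      assume "\<not> ?thesis"
      then have "max 0 (a \<bullet> L $ i) < f a0 / card I" if "i \<in> I" for i
        using that f0 I by auto
      then have "f a < (\<Sum>i\<in>I. f a0 / card I)"
        unfolding f_def using i0(1) by (intro sum_strict_mono) auto
      moreover have "I \<noteq> {}"
        using i0(1) by auto
      ultimately show False
        using a0(2)[of a] a by simp
    qed
  qed
qed

text \<open>
  The index sets \<open>\<I>\<close> whose hull contains \<open>0\<close> are the same for all configurations in \<open>W\<close>; the
  uniform lower bound \<open>r\<close> on the largest real weight is what makes the action proper.
\<close>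

locale lvm_domain =
  fixes W :: "((complex ^ 'm) ^ 'n) set" and \<I> :: "'n set set" and r :: real
  assumes open_W: "open W" and W_nonempty: "W \<noteq> {}" and r_pos: "r > 0"
    and hull_iff: "L \<in> W \<Longrightarrow> 0 \<in> convex hull ((\<lambda>i. L $ i) ` I) \<longleftrightarrow> I \<in> \<I>"
    and direction: "L \<in> W \<Longrightarrow> I \<in> \<I> \<Longrightarrow> \<exists>i\<in>I. r * norm T \<le> Re (weight L i T)"

text \<open>Indices and index sets form finite types, so the least of the individual radii serves
  all of them.\<close>

lemma ex_uniform_radius:
  fixes P :: "'a::finite \<Rightarrow> real \<Rightarrow> bool"
  assumes "\<And>x. \<exists>e>0. P x e" and "\<And>x e e'. P x e \<Longrightarrow> 0 < e' \<Longrightarrow> e' \<le> e \<Longrightarrow> P x e'"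
  shows "\<exists>e>0. \<forall>x. P x e"
proof -
  obtain f where f: "\<And>x. f x > 0 \<and> P x (f x)"
    using assms(1) by metis
  have "Min (range f) > 0"
    using f by (subst Min_gr_iff) auto
  moreover have "Min (range f) \<le> f x" for x
    by simp
  ultimately show ?thesis
    using f assms(2) by (intro exI[of _ "Min (range f)"]) blast
qed

text \<open>Both answers to the question whether 0 lies in a hull have a certificate that survives
  perturbation: a uniform lower bound in all directions for index sets in \<I>, a separating
  direction for the others. The two exclude each other, since a separating \<open>a\<close>
  contradicts the bound in direction \<open>- a\<close>.\<close>

lemma ex_lvm_domain:
  fixes \<Lambda> :: "(complex ^ 'm) ^ 'n"
  assumes n: "CARD('n) > 2 * CARD('m)" and "admissible \<Lambda>" and "open U" "\<Lambda> \<in> U"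
  obtains e \<I> r where "e > 0" "ball \<Lambda> e \<subseteq> U" "lvm_domain (ball \<Lambda> e) \<I> r"
    "\<And>L. L \<in> ball \<Lambda> e \<Longrightarrow> admissible L"
proof -
  define \<I> where "\<I> = {I. 0 \<in> convex hull ((\<lambda>i. \<Lambda> $ i) ` I)}"
  have wh: "weakly_hyperbolic \<Lambda>" and sg: "siegel \<Lambda>"
    using assms(2) by (auto simp: admissible_def)
  have near: "a \<bullet> L $ i \<ge> a \<bullet> \<Lambda> $ i - e" if "norm a = 1" "dist \<Lambda> L \<le> e" for a L e i
  proof -
    have "\<bar>a \<bullet> (\<Lambda> $ i - L $ i)\<bar> \<le> norm a * norm ((\<Lambda> - L) $ i)"
      by (metis Cauchy_Schwarz_ineq2 vector_minus_component)
    also have "\<dots> \<le> dist \<Lambda> L"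
      using that(1) Finite_Cartesian_Product.norm_nth_le[of "\<Lambda> - L" i] by (simp add: dist_norm)
    finally show ?thesis
      using that(2) by (simp add: inner_diff_right)
  qed
  \<comment> \<open>The same number is both the radius and the lower bound, so that the property
    passes to smaller numbers as \<open>ex_uniform_radius\<close> demands.\<close>
  have in_case: "\<exists>e>0. I \<in> \<I> \<longrightarrow> (\<forall>L a. dist \<Lambda> L \<le> e \<longrightarrow> norm a = 1 \<longrightarrow> (\<exists>i\<in>I. a \<bullet> L $ i \<ge> e))" for I
  proof (cases "I \<in> \<I>")
    case True
    then obtain r where r: "r > 0" "\<And>a. norm a = 1 \<Longrightarrow> \<exists>i\<in>I. a \<bullet> \<Lambda> $ i \<ge> r"
      using direction_uniform[OF weakly_hyperbolic_direction[OF wh less_imp_le[OF n], of I]]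
      unfolding \<I>_def mem_Collect_eq by metis
    have "\<exists>i\<in>I. a \<bullet> L $ i \<ge> r / 2" if La: "dist \<Lambda> L \<le> r / 2" "norm a = 1" for L a
    proof -
      obtain i where "i \<in> I" "a \<bullet> \<Lambda> $ i \<ge> r"
        using r(2) La(2) by blast
      then show ?thesis
        using near[OF La(2,1), of i] by (intro bexI[of _ i]) auto
    qed
    then show ?thesis
      using r(1) by (intro exI[of _ "r / 2"]) auto
  qed (auto intro: exI[of _ 1])
  have out_case: "\<exists>e>0. I \<notin> \<I> \<longrightarrow> (\<forall>L. dist \<Lambda> L < e \<longrightarrow> 0 \<notin> convex hull ((\<lambda>i. L $ i) ` I))" for I
  proof (cases "I \<in> \<I>")
    case False
    then obtain a where a: "norm a = 1" "\<And>i. i \<in> I \<Longrightarrow> a \<bullet> \<Lambda> $ i > 0"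
      using hull_separation[of \<Lambda> I] by (auto simp: \<I>_def)
    have "\<exists>e>0. \<forall>i\<in>I. a \<bullet> \<Lambda> $ i > e"
    proof (cases "I = {}")
      case False
      then have "Min ((\<lambda>i. a \<bullet> \<Lambda> $ i) ` I) > 0"
        using a(2) by (subst Min_gr_iff) auto
      moreover have "Min ((\<lambda>i. a \<bullet> \<Lambda> $ i) ` I) \<le> a \<bullet> \<Lambda> $ i" if "i \<in> I" for i
        using that by simp
      ultimately show ?thesis
        by (smt (verit) field_sum_of_halves half_gt_zero)
    qed (auto intro: exI[of _ 1])
    then obtain e where e: "e > 0" "\<And>i. i \<in> I \<Longrightarrow> a \<bullet> \<Lambda> $ i > e"
      by blast
    have "0 \<notin> convex hull ((\<lambda>i. L $ i) ` I)" if "dist \<Lambda> L < e" for L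
    proof -
      have "a \<bullet> L $ i > 0" if "i \<in> I" for i
        using near[OF a(1), of L e i] \<open>dist \<Lambda> L < e\<close> e(2)[OF that] by simp
      then have "(\<lambda>i. L $ i) ` I \<subseteq> {x. a \<bullet> x > 0}"
        by auto
      then have "convex hull ((\<lambda>i. L $ i) ` I) \<subseteq> {x. a \<bullet> x > 0}"
        by (intro hull_minimal convex_halfspace_gt)
      then show ?thesis
        by auto
    qed
    then show ?thesis
      using e(1) by blast
  qed (auto intro: exI[of _ 1])
  have "\<exists>e>0. \<forall>I. I \<in> \<I> \<longrightarrow> (\<forall>L a. dist \<Lambda> L \<le> e \<longrightarrow> norm a = 1 \<longrightarrow> (\<exists>i\<in>I. a \<bullet> L $ i \<ge> e))"
    by (rule ex_uniform_radius[OF in_case]) (meson order_trans)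
  then obtain e1 where e1: "e1 > 0"
    "\<And>I L a. I \<in> \<I> \<Longrightarrow> dist \<Lambda> L \<le> e1 \<Longrightarrow> norm a = 1 \<Longrightarrow> \<exists>i\<in>I. a \<bullet> L $ i \<ge> e1"
    by blast
  have "\<exists>e>0. \<forall>I. I \<notin> \<I> \<longrightarrow> (\<forall>L. dist \<Lambda> L < e \<longrightarrow> 0 \<notin> convex hull ((\<lambda>i. L $ i) ` I))"
    by (rule ex_uniform_radius[OF out_case]) (meson order_less_le_trans)
  then obtain e2 where e2: "e2 > 0"
    "\<And>I L. I \<notin> \<I> \<Longrightarrow> dist \<Lambda> L < e2 \<Longrightarrow> 0 \<notin> convex hull ((\<lambda>i. L $ i) ` I)"
    by blast
  obtain e3 where e3: "e3 > 0" "ball \<Lambda> e3 \<subseteq> U"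
    using assms(3,4) by (meson openE)
  define e where "e = min e1 (min e2 e3)"
  have e: "e > 0" "e \<le> e1" "e \<le> e2" "e \<le> e3"
    using e1(1) e2(1) e3(1) by (auto simp: e_def)
  have dir: "\<exists>i\<in>I. e1 * norm a \<le> a \<bullet> L $ i" if LI: "L \<in> ball \<Lambda> e" "I \<in> \<I>" for L I a
  proof (cases "a = 0")
    case True
    have "I \<noteq> {}"
      using LI(2) by (auto simp: \<I>_def)
    then show ?thesis
      using True by auto
  next
    case False
    then obtain i where "i \<in> I" "sgn a \<bullet> L $ i \<ge> e1"
      using e1(2)[OF LI(2), of L "sgn a"] LI(1) e by (auto simp: norm_sgn)
    then show ?thesis
      using False by (intro bexI[of _ i]) (auto simp: sgn_div_norm field_simps)
  qed
  have iff: "0 \<in> convex hull ((\<lambda>i. L $ i) ` I) \<longleftrightarrow> I \<in> \<I>" if L: "L \<in> ball \<Lambda> e" for L I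
  proof
    show "I \<in> \<I>" if "0 \<in> convex hull ((\<lambda>i. L $ i) ` I)"
      using e2(2)[of I L] that L e by auto
    show "0 \<in> convex hull ((\<lambda>i. L $ i) ` I)" if "I \<in> \<I>"
    proof (rule ccontr)
      assume "0 \<notin> convex hull ((\<lambda>i. L $ i) ` I)"
      then obtain a where a: "norm a = 1" "\<And>i. i \<in> I \<Longrightarrow> a \<bullet> L $ i > 0"
        using hull_separation[of L I] by metis
      then show False
        using dir[OF L that, of "- a"] e1(1) by force
    qed
  qed
  have 1: "lvm_domain (ball \<Lambda> e) \<I> e1"
    using e(1) e1(1) iff dir[of _ _ "cnj_vec _"] by unfold_locales (auto simp: Re_weight)
  have 2: "admissible L" if "L \<in> ball \<Lambda> e" for L
    unfolding admissible_def siegel_def weakly_hyperbolic_def iff[OF that]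
    using wh sg by (auto simp: \<I>_def siegel_def weakly_hyperbolic_def)
  have "ball \<Lambda> e \<subseteq> U"
    using e(4) e3(2) by auto
  then show thesis
    using that[OF e(1) _ 1 2] by blast
qed

section \<open>Complex differentiability\<close>

text \<open>Commuting with \<open>imult\<close> is the Cauchy-Riemann condition on the real
  derivative. Values in an arbitrary complex structure are allowed, unlike in
  \<open>holomorphic_several\<close>, so that charts, group elements and functions can be composed
  by the chain rule.\<close>

definition complex_diff :: "('a::complex_structure \<Rightarrow> 'b::complex_structure) \<Rightarrow> 'a \<Rightarrow> bool" where
  "complex_diff f x \<longleftrightarrow> (\<exists>D. (f has_derivative D) (at x) \<and> (\<forall>v. D (imult v) = imult (D v)))"

lemma holomorphic_several_iff: "holomorphic_several U f \<longleftrightarrow> (\<forall>x\<in>U. complex_diff f x)"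
  by (simp add: holomorphic_several_def complex_diff_def imult_complex_def)

lemma imult_zero [simp]: "imult 0 = 0"
  using imult_scaleR[of 0] by simp

lemma complex_diff_compose:
  assumes "complex_diff f x" "complex_diff g (f x)"
  shows "complex_diff (\<lambda>x. g (f x)) x"
proof -
  obtain D where D: "(f has_derivative D) (at x)" "\<And>v. D (imult v) = imult (D v)"
    using assms(1) by (auto simp: complex_diff_def)
  obtain D' where D': "(g has_derivative D') (at (f x))" "\<And>v. D' (imult v) = imult (D' v)"
    using assms(2) by (auto simp: complex_diff_def)
  show ?thesis
    unfolding complex_diff_def
    using has_derivative_compose[OF D(1) D'(1)] D(2) D'(2) by auto
qed

lemma complex_diff_transform:
  assumes "complex_diff f x" "open S" "x \<in> S" "\<And>y. y \<in> S \<Longrightarrow> f y = g y"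
  shows "complex_diff g x"
  using assms has_derivative_transform_within_open[of f _ x UNIV S g]
  unfolding complex_diff_def by auto

lemma complex_diff_imp_isCont: "complex_diff f x \<Longrightarrow> isCont f x"
  by (auto simp: complex_diff_def dest: has_derivative_continuous)

lemma complex_diff_bounded_linear:
  assumes "bounded_linear f" "\<And>v. f (imult v) = imult (f v)"
  shows "complex_diff f x"
  unfolding complex_diff_def
  using bounded_linear_imp_has_derivative[OF assms(1)] assms(2) by blast

lemma complex_diff_ident [simp]: "complex_diff (\<lambda>x. x) x"
  by (rule complex_diff_bounded_linear) auto

lemma complex_diff_const [simp]: "complex_diff (\<lambda>x. c) x"
  unfolding complex_diff_def by (intro exI[of _ "\<lambda>_. 0"]) auto

lemma complex_diff_field:
  fixes f :: "complex \<Rightarrow> complex"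
  assumes "(f has_field_derivative d) (at z)"
  shows "complex_diff f z"
  unfolding complex_diff_def
  using assms by (intro exI[of _ "(*) d"]) (auto simp: has_field_derivative_def imult_complex_def)

lemma complex_diff_Pair:
  assumes "complex_diff f x" "complex_diff g x"
  shows "complex_diff (\<lambda>x. (f x, g x)) x"
proof -
  obtain D where D: "(f has_derivative D) (at x)" "\<And>v. D (imult v) = imult (D v)"
    using assms(1) by (auto simp: complex_diff_def)
  obtain D' where D': "(g has_derivative D') (at x)" "\<And>v. D' (imult v) = imult (D' v)"
    using assms(2) by (auto simp: complex_diff_def)
  show ?thesis
    unfolding complex_diff_def
    using has_derivative_Pair[OF D(1) D'(1)] D(2) D'(2)
    by (intro exI[of _ "\<lambda>v. (D v, D' v)"]) (auto simp: imult_prod_def)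
qed

lemma complex_diff_fst: "complex_diff f x \<Longrightarrow> complex_diff (\<lambda>x. fst (f x)) x"
  by (rule complex_diff_compose[of f x fst], assumption, rule complex_diff_bounded_linear)
    (auto simp: imult_prod_def bounded_linear_fst)

lemma complex_diff_snd: "complex_diff f x \<Longrightarrow> complex_diff (\<lambda>x. snd (f x)) x"
  by (rule complex_diff_compose[of f x snd], assumption, rule complex_diff_bounded_linear)
    (auto simp: imult_prod_def bounded_linear_snd)

lemma complex_diff_nth: "complex_diff f x \<Longrightarrow> complex_diff (\<lambda>x. f x $ i) x"
  by (rule complex_diff_compose[of f x "\<lambda>v. v $ i"], assumption, rule complex_diff_bounded_linear)
    (auto simp: imult_vec_def bounded_linear_vec_nth)

lemma complex_diff_add:
  assumes "complex_diff f x" "complex_diff g x"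
  shows "complex_diff (\<lambda>x. f x + g x) x"
  using complex_diff_compose[OF complex_diff_Pair[OF assms], of "\<lambda>p. fst p + snd p"]
    complex_diff_bounded_linear[of "\<lambda>p. fst p + snd p" "(f x, g x)"]
  by (simp add: bounded_linear_add bounded_linear_fst bounded_linear_snd imult_prod_def imult_add)

lemma complex_diff_sum:
  assumes "\<And>i. i \<in> I \<Longrightarrow> complex_diff (f i) x"
  shows "complex_diff (\<lambda>x. \<Sum>i\<in>I. f i x) x"
  using assms by (induction I rule: infinite_finite_induct) (auto intro: complex_diff_add)

lemma complex_diff_mult:
  fixes f g :: "'a::complex_structure \<Rightarrow> complex"
  assumes "complex_diff f x" "complex_diff g x"
  shows "complex_diff (\<lambda>x. f x * g x) x"
proof -
  have "((\<lambda>p::complex \<times> complex. fst p * snd p) has_derivative (\<lambda>v. fst (f x, g x) * snd v + fst v * snd (f x, g x))) (at (f x, g x))"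
    by (intro has_derivative_mult has_derivative_fst has_derivative_snd has_derivative_ident)
  then have "complex_diff (\<lambda>p::complex \<times> complex. fst p * snd p) (f x, g x)"
    unfolding complex_diff_def
    by (intro exI[of _ "\<lambda>v. fst (f x, g x) * snd v + fst v * snd (f x, g x)"])
      (auto simp: imult_prod_def imult_complex_def algebra_simps)
  then show ?thesis
    using complex_diff_compose[OF complex_diff_Pair[OF assms], of "\<lambda>p. fst p * snd p"] by simp
qed

lemma complex_diff_prod:
  fixes f :: "'i \<Rightarrow> 'a::complex_structure \<Rightarrow> complex"
  assumes "\<And>i. i \<in> I \<Longrightarrow> complex_diff (f i) x"
  shows "complex_diff (\<lambda>x. \<Prod>i\<in>I. f i x) x"
  using assms by (induction I rule: infinite_finite_induct) (auto intro: complex_diff_mult)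

text \<open>The vector is the sum of the coordinate embeddings of its entries, and these embeddings
  are bounded linear and commute with \<open>imult\<close>.\<close>

lemma complex_diff_vec_lambda:
  fixes f :: "'a::complex_structure \<Rightarrow> 'i::finite \<Rightarrow> 'b::complex_structure"
  assumes "\<And>i. complex_diff (\<lambda>x. f x i) x"
  shows "complex_diff (\<lambda>x. \<chi> i. f x i) x"
proof -
  have "bounded_linear (axis i :: 'b \<Rightarrow> 'b ^ 'i)" for i
  proof (rule bounded_linear_intro[of _ 1])
    fix x :: 'b
    have "norm (axis i x :: 'b ^ 'i) \<le> (\<Sum>j\<in>UNIV. norm ((axis i x :: 'b ^ 'i) $ j))"
      unfolding norm_vec_def by (rule L2_set_le_sum) simp
    also have "\<dots> = (\<Sum>j\<in>UNIV. if j = i then norm x else 0)"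
      by (intro sum.cong) (auto simp: axis_def)
    finally show "norm (axis i x :: 'b ^ 'i) \<le> norm x * 1"
      by simp
  qed (auto simp: axis_def vec_eq_iff)
  moreover have "(axis i (imult v) :: 'b ^ 'i) = imult (axis i v)" for i v
    by (auto simp: axis_def imult_vec_def vec_eq_iff)
  ultimately have "complex_diff (\<lambda>x. axis i (f x i) :: 'b ^ 'i) x" for i
    by (intro complex_diff_compose[OF assms[of i], of "axis i"] complex_diff_bounded_linear)
  then have "complex_diff (\<lambda>x. \<Sum>i\<in>UNIV. axis i (f x i) :: 'b ^ 'i) x"
    by (intro complex_diff_sum)
  moreover have "(\<Sum>i\<in>UNIV. axis i (f x i) :: 'b ^ 'i) = (\<chi> i. f x i)" for x
    by (simp add: vec_eq_iff axis_def)
  ultimately show ?thesis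
    by simp
qed

lemma complex_diff_exp: "complex_diff f x \<Longrightarrow> complex_diff (\<lambda>x. exp (f x :: complex)) x"
  by (rule complex_diff_compose[of f x exp], assumption, rule complex_diff_field, rule DERIV_exp)

lemma complex_diff_inverse:
  fixes f :: "'a::complex_structure \<Rightarrow> complex"
  assumes "complex_diff f x" "f x \<noteq> 0"
  shows "complex_diff (\<lambda>x. inverse (f x)) x"
  using assms(2)
  by (intro complex_diff_compose[OF assms(1), of inverse] complex_diff_field[OF DERIV_inverse])

lemma complex_diff_divide:
  fixes f g :: "'a::complex_structure \<Rightarrow> complex"
  assumes "complex_diff f x" "complex_diff g x" "g x \<noteq> 0"
  shows "complex_diff (\<lambda>x. f x / g x) x"
  using complex_diff_mult[OF assms(1) complex_diff_inverse[OF assms(2,3)]] by (simp add: field_simps)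

lemma complex_diff_Ln:
  assumes "complex_diff f x" "f x \<notin> \<real>\<^sub>\<le>\<^sub>0"
  shows "complex_diff (\<lambda>x. Ln (f x)) x"
  using assms(2) by (intro complex_diff_compose[OF assms(1), of Ln] complex_diff_field[OF has_field_derivative_Ln])

lemma complex_diff_weight:
  assumes "complex_diff L x" "complex_diff T x"
  shows "complex_diff (\<lambda>x. weight (L x) i (T x)) x"
  unfolding weight_def by (intro complex_diff_sum complex_diff_mult complex_diff_nth assms)

lemma complex_diff_det:
  fixes A :: "'a::complex_structure \<Rightarrow> complex ^ 'n ^ 'n"
  assumes "\<And>i j. complex_diff (\<lambda>x. A x $ i $ j) x"
  shows "complex_diff (\<lambda>x. det (A x)) x"
  unfolding det_def by (intro complex_diff_sum complex_diff_mult complex_diff_prod assms complex_diff_const)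

section \<open>The action\<close>

text \<open>
  The group \<open>\<complex>\<^sup>m \<times> \<complex>\<close>, acting on the cone over projective space: the last coordinate
  is the logarithm of a scalar.
\<close>

definition cone_act :: "(complex ^ 'm) ^ 'n \<Rightarrow> complex ^ 'm \<Rightarrow> complex \<Rightarrow> complex ^ 'n \<Rightarrow> complex ^ 'n" where
  "cone_act L T s z = (\<chi> i. z $ i * exp (weight L i T + s))"

lemma cone_act_nth [simp]: "cone_act L T s z $ i = z $ i * exp (weight L i T + s)"
  by (simp add: cone_act_def)

lemma cone_act_zero [simp]: "cone_act L 0 0 z = z"
  by (simp add: vec_eq_iff)

lemma cone_act_cone_act: "cone_act L T s (cone_act L T' s' z) = cone_act L (T + T') (s + s') z"
  by (simp add: vec_eq_iff weight_add exp_add)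

lemma cone_act_minus [simp]: "cone_act L (- T) (- s) (cone_act L T s z) = z"
  "cone_act L T s (cone_act L (- T) (- s) z) = z"
  by (simp_all add: cone_act_cone_act)

text \<open>Every nonzero scalar is an exponential, so scaling is the action of the last group
  coordinate. The configuration \<open>L\<close> is arbitrary because weights vanish at 0.\<close>

lemma proj_point_eq_iff: "proj_point z = proj_point z' \<longleftrightarrow> (\<exists>s. z' = cone_act L 0 s z)"
proof
  assume "proj_point z = proj_point z'"
  moreover have "z' \<in> proj_point z'"
    unfolding proj_point_def by (auto intro!: exI[of _ 1])
  ultimately obtain c where "c \<noteq> 0" "z' = c *s z"
    by (auto simp: proj_point_def)
  then show "\<exists>s. z' = cone_act L 0 s z"
    by (intro exI[of _ "Ln c"]) (simp add: vec_eq_iff mult.commute)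
next
  assume "\<exists>s. z' = cone_act L 0 s z"
  then obtain s where "z' = cone_act L 0 s z" ..
  then have z': "z' = exp s *s z"
    by (simp add: vec_eq_iff mult.commute)
  show "proj_point z = proj_point z'"
  proof
    show "proj_point z' \<subseteq> proj_point z"
      by (force simp: proj_point_def z')
    show "proj_point z \<subseteq> proj_point z'"
    proof
      fix w assume "w \<in> proj_point z"
      then obtain c where "c \<noteq> 0" "w = c *s z"
        by (auto simp: proj_point_def)
      then show "w \<in> proj_point z'"
        unfolding proj_point_def z' by (auto intro!: exI[of _ "c * exp (- s)"] simp: exp_minus)
    qed
  qed
qed

lemma diag_act_proj_point: "diag_act L T ` proj_point z = proj_point (cone_act L T 0 z)"
proof -
  have "diag_act L T (c *s z) = c *s cone_act L T 0 z" for c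
    by (simp add: diag_act_def vec_eq_iff weight_def)
  then show ?thesis
    unfolding proj_point_def by (auto simp: image_iff) metis
qed

lemma lvm_orbit_proj_point: "lvm_orbit L (proj_point z) = {proj_point (cone_act L T 0 z) | T. True}"
  by (simp add: lvm_orbit_def diag_act_proj_point)

text \<open>Here the two quotients merge: scalars act through \<open>s\<close> and commute with the
  action of \<open>T\<close>, so orbits of lines correspond to orbits of vectors under the larger
  group.\<close>

lemma lvm_orbit_eq_iff:
  "lvm_orbit L (proj_point z) = lvm_orbit L (proj_point z') \<longleftrightarrow> (\<exists>T s. z' = cone_act L T s z)"
proof
  assume *: "lvm_orbit L (proj_point z) = lvm_orbit L (proj_point z')"
  have "proj_point z' = proj_point (cone_act L 0 0 z')"
    by simp
  then have "proj_point z' \<in> lvm_orbit L (proj_point z')"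
    unfolding lvm_orbit_proj_point by blast
  then obtain T where "proj_point (cone_act L T 0 z) = proj_point z'"
    unfolding *[symmetric] unfolding lvm_orbit_proj_point by auto
  then show "\<exists>T s. z' = cone_act L T s z"
    unfolding proj_point_eq_iff[of _ _ L] by (auto simp: cone_act_cone_act)
next
  have sub: "lvm_orbit L (proj_point (cone_act L T s z)) \<subseteq> lvm_orbit L (proj_point z)" for T s z
  proof -
    have "proj_point (cone_act L T' 0 (cone_act L T s z)) = proj_point (cone_act L (T' + T) 0 z)" for T'
      unfolding proj_point_eq_iff[of _ _ L] by (auto simp: cone_act_cone_act intro!: exI[of _ "-s"])
    then show ?thesis
      unfolding lvm_orbit_proj_point by auto
  qed
  assume "\<exists>T s. z' = cone_act L T s z"
  then obtain T s where "z' = cone_act L T s z" by blast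
  then show "lvm_orbit L (proj_point z) = lvm_orbit L (proj_point z')"
    using sub[of T s z] sub[of "- T" "- s" z'] by simp
qed

lemma tendsto_cone_act:
  assumes "(L \<longlongrightarrow> L') F" "(T \<longlongrightarrow> T') F" "(s \<longlongrightarrow> s') F" "(z \<longlongrightarrow> z') F"
  shows "((\<lambda>x. cone_act (L x) (T x) (s x) (z x)) \<longlongrightarrow> cone_act L' T' s' z') F"
  unfolding cone_act_def weight_def by (intro tendsto_intros assms)

lemma complex_diff_cone_act:
  assumes "complex_diff L x" "complex_diff T x" "complex_diff s x" "complex_diff z x"
  shows "complex_diff (\<lambda>x. cone_act (L x) (T x) (s x) (z x)) x"
  unfolding cone_act_def
  by (intro complex_diff_vec_lambda complex_diff_mult complex_diff_exp complex_diff_add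
      complex_diff_nth complex_diff_weight assms)

section \<open>The common domain \<open>S\<close>, stabilizers and bounds on group elements\<close>

context lvm_domain
begin

definition S :: "(complex ^ 'n) set" where
  "S = {z. {i. z $ i \<noteq> 0} \<in> \<I>}"

lemma siegel_points_eq: "L \<in> W \<Longrightarrow> siegel_points L = S"
  by (simp add: siegel_points_def S_def hull_iff)

lemma index_mono: "I \<in> \<I> \<Longrightarrow> I \<subseteq> J \<Longrightarrow> J \<in> \<I>"
  using W_nonempty hull_iff by (meson all_not_in_conv hull_mono image_mono subsetD)

lemma index_nonempty: "I \<in> \<I> \<Longrightarrow> I \<noteq> {}"
  using W_nonempty direction by blast

lemma open_S: "open S"
proof (subst open_subopen, intro ballI)
  fix z assume z: "z \<in> S"
  let ?U = "\<Inter>i\<in>{i. z $ i \<noteq> 0}. {y::complex^'n. y $ i \<noteq> 0}"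
  have "open {y::complex^'n. y $ i \<noteq> 0}" for i
    by (intro open_Collect_neq continuous_intros)
  then have "open ?U"
    by (intro open_INT) auto
  moreover have "?U \<subseteq> S"
    using z by (auto simp: S_def intro: index_mono)
  ultimately show "\<exists>T. open T \<and> z \<in> T \<and> T \<subseteq> S"
    by (intro exI[of _ ?U]) auto
qed

lemma cone_act_in_S [simp]: "cone_act L T s z \<in> S \<longleftrightarrow> z \<in> S"
  by (simp add: S_def)

lemma zero_notin_S: "0 \<notin> S"
  using index_nonempty[of "{}"] by (auto simp: S_def)

text \<open>Some coordinate in \<open>K\<close> is multiplied by at least
  \<open>exp (r * norm T + Re s)\<close>, yet its norm only has room to grow by the factor
  \<open>b / a\<close>. The same argument for the inverse element and \<open>K'\<close> bounds
  \<open>r * norm T - Re s\<close>, and the two bounds together control \<open>T\<close> and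
  \<open>Re s\<close>. Two index sets occur because they will be the supports of two different limit
  points.\<close>

lemma cone_act_bound:
  assumes L: "L \<in> W" and K: "K \<in> \<I>" "K' \<in> \<I>" and "a > 0"
    and 1: "\<And>i. i \<in> K \<Longrightarrow> a \<le> norm (z $ i) \<and> norm (cone_act L T s z $ i) \<le> b"
    and 2: "\<And>i. i \<in> K' \<Longrightarrow> norm (z $ i) \<le> b \<and> a \<le> norm (cone_act L T s z $ i)"
  shows "r * norm T \<le> ln (b / a)" "\<bar>Re s\<bar> \<le> ln (b / a)"
proof -
  obtain i where i: "i \<in> K" "r * norm T \<le> Re (weight L i T)"
    using direction[OF L K(1)] by blast
  have "a * exp (Re (weight L i T) + Re s) \<le> norm (z $ i) * exp (Re (weight L i T) + Re s)"
    using 1[OF i(1)] by (intro mult_right_mono) auto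
  also have "\<dots> \<le> b"
    using 1[OF i(1)] by (simp add: norm_mult)
  finally have "exp (Re (weight L i T) + Re s) \<le> b / a"
    using \<open>a > 0\<close> by (simp add: field_simps)
  then have A: "r * norm T + Re s \<le> ln (b / a)"
    using i(2) by (smt (verit) exp_gt_zero ln_exp ln_mono)
  obtain j where j: "j \<in> K'" "r * norm (- T) \<le> Re (weight L j (- T))"
    using direction[OF L K(2)] by blast
  have "a \<le> norm (z $ j) * exp (Re (weight L j T) + Re s)"
    using 2[OF j(1)] by (simp add: norm_mult)
  also have "\<dots> \<le> b * exp (Re (weight L j T) + Re s)"
    using 2[OF j(1)] by (intro mult_right_mono) auto
  finally have "a * exp (- (Re (weight L j T) + Re s))
      \<le> b * exp (Re (weight L j T) + Re s) * exp (- (Re (weight L j T) + Re s))"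
    by (intro mult_right_mono) auto
  also have "\<dots> = b"
    by (simp add: mult.assoc flip: exp_add)
  finally have "exp (- (Re (weight L j T) + Re s)) \<le> b / a"
    using \<open>a > 0\<close> by (simp add: field_simps)
  then have "- (Re (weight L j T) + Re s) \<le> ln (b / a)"
    by (smt (verit) exp_gt_zero ln_exp ln_mono)
  then have B: "r * norm T - Re s \<le> ln (b / a)"
    using j(2) by (simp add: weight_minus)
  show "r * norm T \<le> ln (b / a)"
    using A B by linarith
  have "r * norm T \<ge> 0"
    using r_pos by simp
  then show "\<bar>Re s\<bar> \<le> ln (b / a)"
    using A B by linarith
qed

text \<open>Applying \<open>direction\<close> to \<open>T\<close> and to \<open>- T\<close> bounds
  \<open>r * norm T\<close> by \<open>- c\<close> and by \<open>c\<close>. This nondegeneracy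
  underlies the freeness of the action, the existence of frames and the independence of the
  equations in condition (K).\<close>

lemma Re_weight_const_zero:
  assumes L: "L \<in> W" and I: "I \<in> \<I>" and re: "\<And>i. i \<in> I \<Longrightarrow> Re (weight L i T) + c = 0"
  shows "T = 0" "c = 0"
proof -
  obtain i where i: "i \<in> I" "r * norm T \<le> Re (weight L i T)"
    using direction[OF L I] by blast
  obtain j where j: "j \<in> I" "r * norm (- T) \<le> Re (weight L j (- T))"
    using direction[OF L I] by blast
  have "r * norm T \<le> 0"
    using i j re[of i] re[of j] by (simp add: weight_minus)
  then show "T = 0"
    using r_pos by (simp add: mult_le_0_iff)
  then show "c = 0"
    using re[OF i(1)] by simp
qed

text \<open>On the support of \<open>z\<close> all exponentials equal 1, so the real parts of the
  exponents vanish there and \<open>T\<close> must be 0. What remains of the stabilizer is the group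
  of periods 2 pi i k, from which the bound on \<open>Im s\<close> selects 0.\<close>

lemma cone_act_fixed:
  assumes L: "L \<in> W" and z: "z \<in> S" and fix_z: "cone_act L T s z = z" and s: "\<bar>Im s\<bar> \<le> pi"
  shows "T = 0" "s = 0"
proof -
  let ?I = "{i. z $ i \<noteq> 0}"
  have I: "?I \<in> \<I>"
    using z by (simp add: S_def)
  have e: "exp (weight L i T + s) = 1" if "i \<in> ?I" for i
    using that fix_z by (auto simp: vec_eq_iff)
  have re: "Re (weight L i T) + Re s = 0" if "i \<in> ?I" for i
    using e[OF that] by (metis exp_eq_1 plus_complex.simps(1))
  show T: "T = 0"
    using Re_weight_const_zero[OF L I re] by blast
  obtain i where "i \<in> ?I"
    using index_nonempty[OF I] by blast
  then have "exp s = 1"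
    using e[of i] T by simp
  then have "Re s = 0" and "\<exists>n::int. Im s = of_int (2 * n) * pi"
    by (auto simp: exp_eq_1)
  then obtain n :: int where n: "Im s = of_int (2 * n) * pi" by blast
  have "\<bar>of_int (2 * n) * pi\<bar> \<le> 1 * pi"
    using s n by simp
  then have "\<bar>real_of_int (2 * n)\<bar> \<le> 1"
    unfolding abs_mult using pi_gt_zero by (simp only: abs_of_pos mult_le_cancel_right_pos)
  then have "n = 0"
    by linarith
  then show "s = 0"
    using n \<open>Re s = 0\<close> by (simp add: complex_eq_iff)
qed

text \<open>The action sees \<open>s\<close> only through \<open>exp s\<close>, so the principal
  logarithm may replace it. This bounds \<open>Im s\<close>, the one part of the group element that
  \<open>cone_act_bound\<close> leaves uncontrolled.\<close>

lemma cone_act_reduce: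
  obtains s' where "\<bar>Im s'\<bar> \<le> pi" "\<And>z. cone_act L T s z = cone_act L T s' z"
proof -
  have "exp (Ln (exp s)) = exp s"
    by simp
  then have "cone_act L T s z = cone_act L T (Ln (exp s)) z" for z
    by (simp only: vec_eq_iff cone_act_nth exp_add) simp
  moreover have "\<bar>Im (Ln (exp s))\<bar> \<le> pi"
    using mpi_less_Im_Ln[of "exp s"] Im_Ln_le_pi[of "exp s"] by (simp add: abs_le_iff)
  ultimately show thesis
    using that by blast
qed

text \<open>Properness of the action, in terms of sequences.\<close>

lemma cone_act_subseq:
  assumes LW: "\<And>k. L k \<in> W" and lim: "L \<longlonglongrightarrow> L0" "z \<longlonglongrightarrow> z0" "(\<lambda>k. cone_act (L k) (T k) (s k) (z k)) \<longlonglongrightarrow> z1"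
    and S: "z0 \<in> S" "z1 \<in> S" and s: "\<And>k. \<bar>Im (s k)\<bar> \<le> pi"
  obtains T0 s0 \<phi> where "strict_mono \<phi>" "(T \<circ> \<phi>) \<longlonglongrightarrow> T0" "(s \<circ> \<phi>) \<longlonglongrightarrow> s0" "z1 = cone_act L0 T0 s0 z0"
    "\<bar>Im s0\<bar> \<le> pi"
proof -
  let ?K = "\<lambda>z::complex^'n. {i. z $ i \<noteq> 0}"
  let ?z' = "\<lambda>k. cone_act (L k) (T k) (s k) (z k)"
  \<comment> \<open>A strict lower bound for the nonzero coordinates of both limits; being strict,
    it holds for the two sequences from some index on.\<close>
  have "\<exists>a>0. \<forall>i. (z0 $ i \<noteq> 0 \<longrightarrow> a < norm (z0 $ i)) \<and> (z1 $ i \<noteq> 0 \<longrightarrow> a < norm (z1 $ i))"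
  proof (rule ex_uniform_radius)
    fix i
    have "\<exists>a>0. x \<noteq> 0 \<longrightarrow> a < norm x" for x :: complex
      by (cases "x = 0") (auto intro: exI[of _ 1] dense simp flip: zero_less_norm_iff)
    then obtain a b where ab: "a > 0" "z0 $ i \<noteq> 0 \<longrightarrow> a < norm (z0 $ i)" "b > 0" "z1 $ i \<noteq> 0 \<longrightarrow> b < norm (z1 $ i)"
      by meson
    then show "\<exists>a>0. (z0 $ i \<noteq> 0 \<longrightarrow> a < norm (z0 $ i)) \<and> (z1 $ i \<noteq> 0 \<longrightarrow> a < norm (z1 $ i))"
      by (intro exI[of _ "min a b"]) auto
  qed auto
  then obtain a where a: "a > 0" "\<And>i. z0 $ i \<noteq> 0 \<Longrightarrow> a < norm (z0 $ i)" "\<And>i. z1 $ i \<noteq> 0 \<Longrightarrow> a < norm (z1 $ i)"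
    by blast
  have low: "\<forall>\<^sub>F k in sequentially. \<forall>i\<in>?K w. a < norm (y k $ i)"
    if "y \<longlonglongrightarrow> w" "\<And>i. w $ i \<noteq> 0 \<Longrightarrow> a < norm (w $ i)" for y :: "nat \<Rightarrow> complex^'n" and w
  proof (rule eventually_ball_finite)
    show "\<forall>i\<in>?K w. \<forall>\<^sub>F k in sequentially. a < norm (y k $ i)"
      using that by (auto intro!: order_tendstoD(1)[OF tendsto_norm[OF tendsto_vec_nth]])
  qed auto
  obtain b where b: "\<And>k. norm (z k) \<le> b" "\<And>k. norm (?z' k) \<le> b"
  proof -
    obtain b1 where "\<And>k. norm (z k) \<le> b1"
      using convergent_imp_Bseq[OF convergentI[OF lim(2)]] by (auto simp: Bseq_def)
    moreover obtain b2 where "\<And>k. norm (?z' k) \<le> b2"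
      using convergent_imp_Bseq[OF convergentI[OF lim(3)]] by (auto simp: Bseq_def)
    ultimately show thesis
      using that[of "max b1 b2"] by (meson max.coboundedI1 max.coboundedI2)
  qed
  obtain N where N: "\<And>k i. k \<ge> N \<Longrightarrow> i \<in> ?K z0 \<Longrightarrow> a < norm (z k $ i)"
    "\<And>k i. k \<ge> N \<Longrightarrow> i \<in> ?K z1 \<Longrightarrow> a < norm (?z' k $ i)"
    using eventually_conj[OF low[OF lim(2) a(2)] low[OF lim(3) a(3)]]
    unfolding eventually_sequentially by blast
  let ?C = "ln (b / a)"
  have bd: "r * norm (T k) \<le> ?C \<and> \<bar>Re (s k)\<bar> \<le> ?C" if "k \<ge> N" for k
  proof -
    have n: "norm (z k $ i) \<le> b" "norm (?z' k $ i) \<le> b" for i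
      using b Finite_Cartesian_Product.norm_nth_le order_trans by blast+
    have "?K z0 \<in> \<I>" "?K z1 \<in> \<I>"
      using S by (auto simp: S_def)
    note * = cone_act_bound[OF LW[of k] this \<open>a > 0\<close>, of "z k" "T k" "s k" b]
    show ?thesis
      using N[OF that] n by (intro conjI *) (auto intro: less_imp_le simp del: cone_act_nth)
  qed
  have "bounded (range (\<lambda>k. (T (k + N), s (k + N))))"
  proof (rule boundedI)
    fix x assume "x \<in> range (\<lambda>k. (T (k + N), s (k + N)))"
    then obtain k where x: "x = (T (k + N), s (k + N))" by auto
    have "norm x \<le> norm (T (k + N)) + norm (s (k + N))"
      unfolding x by (rule norm_Pair_le)
    also have "norm (T (k + N)) \<le> ?C / r"
      using bd[of "k + N"] r_pos by (simp add: field_simps)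
    also have "norm (s (k + N)) \<le> ?C + pi"
      using cmod_le[of "s (k + N)"] bd[of "k + N"] s[of "k + N"] by simp
    finally show "norm x \<le> ?C / r + (?C + pi)"
      by simp
  qed
  then obtain l \<psi> where psi: "strict_mono \<psi>" "((\<lambda>k. (T (k + N), s (k + N))) \<circ> \<psi>) \<longlonglongrightarrow> l"
    using bounded_imp_convergent_subsequence by blast
  \<comment> \<open>The bounds hold only from index \<open>N\<close> on, so the subsequence was
    extracted from the tail and its indices are shifted back.\<close>
  define \<phi> where "\<phi> k = \<psi> k + N" for k
  have phi: "strict_mono \<phi>"
    using psi(1) by (simp add: \<phi>_def strict_mono_def)
  have T: "(T \<circ> \<phi>) \<longlonglongrightarrow> fst l" and s': "(s \<circ> \<phi>) \<longlonglongrightarrow> snd l"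
    using tendsto_fst[OF psi(2)] tendsto_snd[OF psi(2)] by (auto simp: o_def \<phi>_def)
  have "(?z' \<circ> \<phi>) \<longlonglongrightarrow> cone_act L0 (fst l) (snd l) z0"
    using tendsto_cone_act[OF LIMSEQ_subseq_LIMSEQ[OF lim(1) phi] T s' LIMSEQ_subseq_LIMSEQ[OF lim(2) phi]]
    by (simp add: o_def)
  then have "z1 = cone_act L0 (fst l) (snd l) z0"
    using LIMSEQ_unique[OF LIMSEQ_subseq_LIMSEQ[OF lim(3) phi]] by (simp add: o_def)
  moreover have "\<bar>Im (snd l)\<bar> \<le> pi"
    using s by (intro tendsto_upperbound[OF tendsto_rabs[OF tendsto_Im[OF s']]]) auto
  ultimately show thesis
    using that phi T s' by blast
qed

end

section \<open>Topology of the family\<close>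

lemma second_countable_euclidean: "second_countable (euclidean :: 'a::second_countable_topology topology)"
proof -
  obtain \<B> :: "'a set set" where "countable \<B>" "topological_basis \<B>"
    using ex_countable_basis by blast
  then show ?thesis
    unfolding second_countable_def open_openin[symmetric]
    by (intro exI[of _ \<B>]) (metis topological_basis_open topological_basisE)
qed

definition fam_proj ::
    "((complex ^ 'm) ^ 'n) \<times> (complex ^ 'n) \<Rightarrow> ((complex ^ 'm) ^ 'n) \<times> (complex ^ 'n) set set" where
  "fam_proj p = (fst p, lvm_orbit (fst p) (proj_point (snd p)))"

lemma fst_fam_proj [simp]: "fst (fam_proj p) = fst p"
  by (simp add: fam_proj_def)

lemma fam_proj_eq_iff:
  "fam_proj (L, z) = fam_proj (L', z') \<longleftrightarrow> L = L' \<and> (\<exists>T s. z' = cone_act L T s z)"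
  by (simp add: fam_proj_def cong: conj_cong flip: lvm_orbit_eq_iff)

lemma fam_proj_cone_act [simp]: "fam_proj (L, cone_act L T s z) = fam_proj (L, z)"
  by (metis fam_proj_eq_iff)

lemma continuous_cone_act:
  fixes L :: "'a::topological_space \<Rightarrow> (complex ^ 'm) ^ 'n"
  assumes "continuous_on A L" "continuous_on A z"
  shows "continuous_on A (\<lambda>p. cone_act (L p) T s (z p))"
  using assms unfolding continuous_on_def by (auto intro!: tendsto_cone_act)

context lvm_domain
begin

abbreviation "E \<equiv> LVM_family W"

lemma total_eq: "{(\<Lambda>, z). \<Lambda> \<in> W \<and> z \<in> siegel_points \<Lambda>} = W \<times> S"
  using siegel_points_eq by auto

lemma E_eq: "E = cs_quotient (open_cspace (W \<times> S)) fam_proj"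
  unfolding LVM_family_def total_eq by (simp add: fam_proj_def[abs_def] case_prod_beta')

lemma open_total: "open (W \<times> S)"
  by (intro open_Times open_W open_S)

lemma quotient_map_E: "quotient_map (top_of_set (W \<times> S)) (cs_top E) fam_proj"
  using quotient_map_cs_quotient[of "open_cspace (W \<times> S)" fam_proj]
  by (simp add: E_eq open_cspace_def)

lemma points_E: "cs_points E = fam_proj ` (W \<times> S)"
  using quotient_imp_surjective_map[OF quotient_map_E] by simp

lemma openin_E: "openin (cs_top E) U \<longleftrightarrow> U \<subseteq> fam_proj ` (W \<times> S) \<and> open {x \<in> W \<times> S. fam_proj x \<in> U}"
  unfolding E_eq openin_cs_quotient
  by (auto simp: open_cspace_def openin_open_eq[OF open_total])

lemma hol_E: "cs_hol E U f \<longleftrightarrow> (\<forall>x \<in> W \<times> S. fam_proj x \<in> U \<longrightarrow> complex_diff (f \<circ> fam_proj) x)"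
  by (auto simp: E_eq cs_quotient_def open_cspace_def holomorphic_several_iff)

text \<open>As always for a quotient by a group acting continuously, the saturation of an open set
  is open: it is the union of the preimages of \<open>N\<close> under single group elements.\<close>

lemma openin_fam_proj:
  assumes "open N" "N \<subseteq> W \<times> S"
  shows "openin (cs_top E) (fam_proj ` N)"
proof -
  have "{x \<in> W \<times> S. fam_proj x \<in> fam_proj ` N}
      = (W \<times> S) \<inter> (\<Union>T. \<Union>s. {x. (fst x, cone_act (fst x) T s (snd x)) \<in> N})" (is "_ = ?R")
  proof (intro equalityI subsetI)
    fix x assume "x \<in> {x \<in> W \<times> S. fam_proj x \<in> fam_proj ` N}"
    then obtain y where y: "x \<in> W \<times> S" "y \<in> N" "fam_proj x = fam_proj y"
      by auto
    then obtain T s where "y = (fst x, cone_act (fst x) T s (snd x))"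
      using fam_proj_eq_iff[of "fst x" "snd x" "fst y" "snd y"] by (auto simp: prod_eq_iff)
    then show "x \<in> ?R"
      using y(1,2) by blast
  next
    fix x assume x: "x \<in> ?R"
    then obtain T s where "(fst x, cone_act (fst x) T s (snd x)) \<in> N"
      by blast
    then have "fam_proj (fst x, snd x) \<in> fam_proj ` N"
      by (metis fam_proj_cone_act imageI)
    then show "x \<in> {x \<in> W \<times> S. fam_proj x \<in> fam_proj ` N}"
      using x by simp
  qed
  moreover have "open {x. (fst x, cone_act (fst x) T s (snd x)) \<in> N}" for T s
  proof -
    have "continuous_on UNIV (\<lambda>x. (fst x, cone_act (fst x) T s (snd x)) :: ((complex ^ 'm) ^ 'n) \<times> (complex ^ 'n))"
      by (intro continuous_on_Pair continuous_cone_act continuous_on_fst continuous_on_snd continuous_on_id)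
    from open_vimage[OF assms(1) this] show ?thesis
      by (simp add: vimage_def)
  qed
  ultimately show ?thesis
    unfolding openin_E using assms open_total by (auto intro!: open_Int open_UN)
qed

text \<open>If shrinking neighbourhoods of two points always met, there would be sequences
  converging to representatives of the two points and lying pairwise in common orbits. By
  \<open>cone_act_subseq\<close> the limits would then lie in one orbit.\<close>

lemma Hausdorff_E: "Hausdorff_space (cs_top E)"
  unfolding Hausdorff_space_def
proof (intro allI impI)
  fix x y assume "x \<in> cs_points E \<and> y \<in> cs_points E \<and> x \<noteq> y"
  then obtain p p' where p: "p \<in> W \<times> S" "x = fam_proj p" and p': "p' \<in> W \<times> S" "y = fam_proj p'"
    and ne: "x \<noteq> y"
    by (auto simp: points_E)
  let ?N = "\<lambda>c k. ball c (inverse (real (Suc k))) \<inter> (W \<times> S)"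
  have opn: "openin (cs_top E) (fam_proj ` ?N c k)" for c k
    using open_total by (intro openin_fam_proj) auto
  have "\<exists>k. disjnt (fam_proj ` ?N p k) (fam_proj ` ?N p' k)"
  proof (rule ccontr)
    assume "\<not> ?thesis"
    then have "\<forall>k. \<exists>u v. u \<in> ?N p k \<and> v \<in> ?N p' k \<and> fam_proj u = fam_proj v"
      unfolding disjnt_iff by blast
    then obtain u v where uv: "\<And>k. u k \<in> ?N p k" "\<And>k. v k \<in> ?N p' k" "\<And>k. fam_proj (u k) = fam_proj (v k)"
      by metis
    have lim: "w \<longlonglongrightarrow> c" if "\<And>k. w k \<in> ?N c k" for w c
    proof (rule metric_LIMSEQ_I)
      fix e :: real assume "e > 0"
      then obtain n where "inverse (real (Suc n)) < e"
        using reals_Archimedean by blast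
      moreover have "dist (w k) c < inverse (real (Suc n))" if "k \<ge> n" for k
      proof -
        have "dist (w k) c < inverse (real (Suc k))"
          using \<open>\<And>k. w k \<in> ?N c k\<close>[of k] by (simp add: dist_commute)
        also have "\<dots> \<le> inverse (real (Suc n))"
          using that by (intro le_imp_inverse_le) auto
        finally show ?thesis .
      qed
      ultimately show "\<exists>n. \<forall>k\<ge>n. dist (w k) c < e"
        by (meson less_trans)
    qed
    have u: "u \<longlonglongrightarrow> p" and v: "v \<longlonglongrightarrow> p'"
      using lim uv by blast+
    have fst_eq: "fst (v k) = fst (u k)" for k
      using uv(3)[of k] by (metis fst_fam_proj)
    then have fp: "fst p' = fst p"
      using LIMSEQ_unique[OF tendsto_fst[OF u]] tendsto_fst[OF v] by simp
    have "\<exists>T s. \<bar>Im s\<bar> \<le> pi \<and> snd (v k) = cone_act (fst (u k)) T s (snd (u k))" for k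
    proof -
      obtain T s where "snd (v k) = cone_act (fst (u k)) T s (snd (u k))"
        using uv(3)[of k] fam_proj_eq_iff[of "fst (u k)" "snd (u k)" "fst (v k)" "snd (v k)"] by auto
      then show ?thesis
        using cone_act_reduce[where s = s and L = "fst (u k)" and T = T] by metis
    qed
    then obtain T s where Ts: "\<And>k. \<bar>Im (s k)\<bar> \<le> pi" "\<And>k. snd (v k) = cone_act (fst (u k)) (T k) (s k) (snd (u k))"
      by metis
    obtain T0 s0 where "snd p' = cone_act (fst p) T0 s0 (snd p)"
    proof (rule cone_act_subseq[of "\<lambda>k. fst (u k)" "fst p" "\<lambda>k. snd (u k)" "snd p" T s "snd p'"])
      show "fst (u k) \<in> W" for k
        using uv(1)[of k] by auto
      show "(\<lambda>k. cone_act (fst (u k)) (T k) (s k) (snd (u k))) \<longlonglongrightarrow> snd p'"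
        using tendsto_snd[OF v] by (simp add: Ts(2))
    qed (use u p p' Ts(1) in \<open>auto intro: tendsto_fst tendsto_snd\<close>)
    then have "x = y"
      using fam_proj_cone_act[of "fst p" T0 s0 "snd p"] fp p(2) p'(2) by (metis prod.collapse)
    then show False
      using ne by simp
  qed
  then obtain k where "disjnt (fam_proj ` ?N p k) (fam_proj ` ?N p' k)" ..
  moreover have "x \<in> fam_proj ` ?N p k" "y \<in> fam_proj ` ?N p' k"
    using p p' by auto
  ultimately show "\<exists>U V. openin (cs_top E) U \<and> openin (cs_top E) V \<and> x \<in> U \<and> y \<in> V \<and> disjnt U V"
    using opn by blast
qed

lemma second_countable_E: "second_countable (cs_top E)"
proof (rule second_countable_open_map_image)
  show "continuous_map (top_of_set (W \<times> S)) (cs_top E) fam_proj"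
    using quotient_map_E by (rule quotient_imp_continuous_map)
  show "open_map (top_of_set (W \<times> S)) (cs_top E) fam_proj"
    unfolding open_map_def openin_open_eq[OF open_total] using openin_fam_proj by auto
  show "fam_proj ` topspace (top_of_set (W \<times> S)) = cs_points E"
    by (simp add: points_E)
  show "second_countable (top_of_set (W \<times> S))"
    by (intro second_countable_subtopology second_countable_euclidean)
qed

text \<open>
  The points of \<open>W \<times> S\<close> of minimal norm in their orbit, normalized; these represent all orbits
  and are cut out by closed conditions.
\<close>

definition min_vectors :: "((complex ^ 'm) ^ 'n) set \<Rightarrow> (((complex ^ 'm) ^ 'n) \<times> (complex ^ 'n)) set" where
  "min_vectors C = {p \<in> C \<times> sphere 0 1. \<forall>T. 1 \<le> norm (cone_act (fst p) T 0 (snd p))}"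

lemma compact_min_vectors:
  assumes "compact C"
  shows "compact (min_vectors C)"
proof -
  have "min_vectors C = (C \<times> sphere 0 1) \<inter> (\<Inter>T. {p. 1 \<le> norm (cone_act (fst p) T 0 (snd p))})"
    by (auto simp: min_vectors_def)
  moreover have "closed {p::((complex ^ 'm) ^ 'n) \<times> (complex ^ 'n). 1 \<le> norm (cone_act (fst p) T 0 (snd p))}" for T
    by (intro closed_Collect_le continuous_intros continuous_cone_act)
  ultimately show ?thesis
    using assms by (auto intro!: compact_Int_closed compact_Times closed_INT)
qed

lemma norm_less_if_nth:
  fixes x y :: "complex ^ 'k"
  assumes "\<And>i. norm (x $ i) \<le> norm (y $ i)" "norm (x $ j) < norm (y $ j)"
  shows "norm x < norm y"
  unfolding norm_vec_def L2_set_def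
  using assms by (intro real_sqrt_less_mono sum_strict_mono_ex1)
    (auto intro!: power_mono power_strict_mono bexI[of _ j])

text \<open>Were 0 outside the hull of the support, flowing against a separating direction would
  shrink every nonzero coordinate and contradict minimality. Hence limits of minimal vectors cannot
  escape from the open set \<open>S\<close>.\<close>

lemma min_vectors_subset:
  assumes "C \<subseteq> W"
  shows "min_vectors C \<subseteq> C \<times> S"
proof
  fix p assume p: "p \<in> min_vectors C"
  obtain L z where Lz: "p = (L, z)" by force
  have z: "norm z = 1" "L \<in> C" "\<And>T. 1 \<le> norm (cone_act L T 0 z)"
    using p by (auto simp: min_vectors_def Lz)
  have "{i. z $ i \<noteq> 0} \<in> \<I>"
  proof (rule ccontr)
    assume "\<not> ?thesis"
    then have "0 \<notin> convex hull ((\<lambda>i. L $ i) ` {i. z $ i \<noteq> 0})"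
      using hull_iff z(2) assms by blast
    then obtain a where a: "\<And>i. z $ i \<noteq> 0 \<Longrightarrow> a \<bullet> L $ i > 0"
      by (rule hull_separation) auto
    define T where "T = cnj_vec (- a)"
    have less: "norm (cone_act L T 0 z $ i) < norm (z $ i)" if "z $ i \<noteq> 0" for i
      using a[OF that] that by (simp add: norm_mult T_def Re_weight)
    obtain j where "z $ j \<noteq> 0"
      using z(1) by (metis norm_zero vec_eq_iff zero_index zero_neq_one)
    moreover have "norm (cone_act L T 0 z $ i) \<le> norm (z $ i)" for i
      using less[of i] by (cases "z $ i = 0") auto
    ultimately have "norm (cone_act L T 0 z) < norm z"
      using less by (intro norm_less_if_nth)
    then show False
      using z(1) z(3)[of T] by simp
  qed
  then show "p \<in> C \<times> S"
    using z(2) by (simp add: S_def Lz)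
qed

text \<open>The norm along the orbit is coercive: the bound in \<open>direction\<close> and
  \<open>exp x \<ge> 1 + x\<close> make it grow at least linearly in \<open>norm T\<close>.\<close>

lemma min_vector_exists:
  assumes "L \<in> W" "z \<in> S"
  obtains T s where "(L, cone_act L T s z) \<in> min_vectors {L}"
proof -
  let ?f = "\<lambda>T. norm (cone_act L T 0 z)"
  have cont: "continuous_on UNIV ?f"
    by (intro continuous_on_norm) (auto simp: continuous_on_def intro!: tendsto_cone_act)
  have I: "{i. z $ i \<noteq> 0} \<in> \<I>"
    using assms(2) by (simp add: S_def)
  have "\<exists>a>0. \<forall>i. z $ i \<noteq> 0 \<longrightarrow> a \<le> norm (z $ i)"
  proof (rule ex_uniform_radius)
    show "\<exists>a>0. z $ i \<noteq> 0 \<longrightarrow> a \<le> norm (z $ i)" for i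
      by (cases "z $ i = 0") (auto intro: exI[of _ 1] exI[of _ "norm (z $ i)"])
  qed auto
  then obtain a where a: "a > 0" "\<And>i. z $ i \<noteq> 0 \<Longrightarrow> a \<le> norm (z $ i)"
    by blast
  have low: "a * (1 + r * norm T) \<le> ?f T" for T
  proof -
    obtain i where i: "z $ i \<noteq> 0" "r * norm T \<le> Re (weight L i T)"
      using direction[OF assms(1) I] by blast
    have "1 + r * norm T \<le> exp (Re (weight L i T))"
      using i(2) exp_ge_add_one_self[of "Re (weight L i T)"] by linarith
    then have "a * (1 + r * norm T) \<le> norm (z $ i) * exp (Re (weight L i T))"
      using a i(1) r_pos by (intro mult_mono) auto
    also have "\<dots> \<le> ?f T"
      using Finite_Cartesian_Product.norm_nth_le[of "cone_act L T 0 z" i] by (simp add: norm_mult)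
    finally show ?thesis .
  qed
  \<comment> \<open>Beyond this radius the linear lower bound already exceeds the value at 0, so the
    minimum over a compact ball is the global one.\<close>
  define R where "R = ?f 0 / (a * r)"
  have R: "?f 0 < ?f T" if "norm T > R" for T
  proof -
    have "?f 0 = a * (r * R)"
      using a(1) r_pos by (simp add: R_def)
    also have "\<dots> < a * (1 + r * norm T)"
      using that a(1) r_pos by (intro mult_strict_left_mono) (auto intro: less_le_trans[of _ "r * norm T"])
    finally show ?thesis
      using low[of T] by simp
  qed
  have "R \<ge> 0"
    using a(1) r_pos by (simp add: R_def)
  then obtain T0 where T0: "T0 \<in> cball 0 R" "\<And>T. T \<in> cball 0 R \<Longrightarrow> ?f T0 \<le> ?f T"
    using continuous_attains_inf[of "cball 0 R" ?f] continuous_on_subset[OF cont] by auto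
  have min: "?f T0 \<le> ?f T" for T
  proof (cases "norm T \<le> R")
    case False
    then show ?thesis
      using R[of T] T0(2)[of 0] \<open>R \<ge> 0\<close> by auto
  qed (use T0(2) in auto)
  have pos: "?f T0 > 0"
    using a(1) r_pos by (intro less_le_trans[OF _ low[of T0]]) (auto intro!: mult_pos_pos add_pos_nonneg)
  \<comment> \<open>Scaling by \<open>exp t\<close> makes the minimal norm equal to 1. It multiplies
    the norms for all \<open>T\<close> alike, so minimality is preserved.\<close>
  define t where "t = - ln (?f T0)"
  have scale: "norm (cone_act L T (of_real t) z) = exp t * ?f T" for T
  proof -
    have "cone_act L T (of_real t) z = exp t *\<^sub>R cone_act L T 0 z"
      by (simp add: vec_eq_iff exp_add scaleR_conv_of_real[where 'a = complex] exp_of_real[where 'a = complex])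
    then show ?thesis
      by simp
  qed
  have "exp t = 1 / ?f T0"
    using pos by (simp add: t_def exp_minus inverse_eq_divide)
  then have "norm (cone_act L T0 (of_real t) z) = 1" "\<And>T. 1 \<le> norm (cone_act L T (of_real t) z)"
    using pos min by (auto simp: scale)
  then show thesis
    by (intro that[of T0 "of_real t"]) (auto simp: min_vectors_def cone_act_cone_act)
qed

text \<open>The base is metrizable, so compact preimages of compact sets suffice; the preimage of
  \<open>C\<close> is the image of the compact set \<open>min_vectors C\<close>.\<close>

lemma proper_E: "proper_map (cs_top E) (top_of_set W) fst"
proof (rule compact_imp_proper_map)
  show "k_space (top_of_set W)"
    by (intro metrizable_imp_k_space metrizable_space_subtopology metrizable_space_euclidean)
  show "kc_space (top_of_set W)"
    by (intro Hausdorff_imp_kc_space) (simp add: Hausdorff_space_subtopology)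
  show "fst \<in> cs_points E \<rightarrow> topspace (top_of_set W)"
    by (auto simp: points_E)
  show "continuous_map (cs_top E) (top_of_set W) fst \<or> kc_space (cs_top E)"
    using Hausdorff_imp_kc_space[OF Hausdorff_E] by blast
  fix C assume "compactin (top_of_set W) C"
  then have C: "compact C" "C \<subseteq> W"
    by (auto simp: compactin_subtopology)
  have "compactin (top_of_set (W \<times> S)) (min_vectors C)"
    using compact_min_vectors[OF C(1)] min_vectors_subset[OF C(2)] C(2)
    by (auto simp: compactin_subtopology)
  then have "compactin (cs_top E) (fam_proj ` min_vectors C)"
    using quotient_imp_continuous_map[OF quotient_map_E] by (rule image_compactin)
  moreover have "fam_proj ` min_vectors C = {x \<in> cs_points E. fst x \<in> C}"
  proof (intro equalityI subsetI)
    fix x assume "x \<in> fam_proj ` min_vectors C"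
    then show "x \<in> {x \<in> cs_points E. fst x \<in> C}"
      using min_vectors_subset[OF C(2)] C(2) by (force simp: points_E)
  next
    fix x assume "x \<in> {x \<in> cs_points E. fst x \<in> C}"
    then obtain L z where x: "x = fam_proj (L, z)" "L \<in> W" "z \<in> S" "L \<in> C"
      by (auto simp: points_E)
    then obtain T s where "(L, cone_act L T s z) \<in> min_vectors {L}"
      using min_vector_exists by blast
    then have "(L, cone_act L T s z) \<in> min_vectors C"
      using x(4) by (auto simp: min_vectors_def)
    then show "x \<in> fam_proj ` min_vectors C"
      by (metis x(1) fam_proj_cone_act imageI)
  qed
  ultimately show "compactin (cs_top E) {x \<in> cs_points E. fst x \<in> C}"
    by simp
qed

end

section \<open>Slices and charts\<close>

text \<open>The matrix of the linear system for the m + 1 parameters of a group element: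
  \<open>Some j\<close> indexes the components of \<open>T\<close>, \<open>None\<close> the scalar
  \<open>s\<close>. Row \<alpha> yields the exponent by which the coordinate \<kappa> \<alpha> is
  multiplied.\<close>

definition frame :: "('m option \<Rightarrow> 'n) \<Rightarrow> (complex ^ 'm) ^ 'n \<Rightarrow> complex ^ 'm option ^ 'm option" where
  "frame \<kappa> L = (\<chi> \<alpha> \<beta>. case \<beta> of Some j \<Rightarrow> L $ \<kappa> \<alpha> $ j | None \<Rightarrow> 1)"

lemma sum_option: "(\<Sum>x\<in>(UNIV::'a::finite option set). f x) = f None + (\<Sum>x\<in>UNIV. f (Some x))"
  by (simp add: UNIV_option_conv sum.reindex)

lemma frame_mult_nth: "(frame \<kappa> L *v x) $ \<alpha> = weight L (\<kappa> \<alpha>) (\<chi> j. x $ Some j) + x $ None"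
  by (simp add: frame_def matrix_vector_mult_def sum_option weight_def)

lemma complex_diff_frame:
  assumes "complex_diff L x"
  shows "complex_diff (\<lambda>x. frame \<kappa> (L x) $ \<alpha> $ \<beta>) x"
  using assms by (cases \<beta>) (auto simp: frame_def intro: complex_diff_nth)

lemma complex_diff_if:
  assumes "c \<Longrightarrow> complex_diff f x" "\<not> c \<Longrightarrow> complex_diff g x"
  shows "complex_diff (\<lambda>x. if c then f x else g x) x"
  using assms by (cases c) auto

context lvm_domain
begin

lemma weight_const_zero:
  assumes L: "L \<in> W" and I: "I \<in> \<I>" and "\<And>i. i \<in> I \<Longrightarrow> weight L i T + s = 0"
  shows "T = 0" "s = 0"
proof -
  have re: "Re (weight L i T) + Re s = 0" if "i \<in> I" for i
    using assms(3)[OF that] by (metis plus_complex.simps(1) zero_complex.simps(1))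
  show T: "T = 0"
    using Re_weight_const_zero[OF L I re] by blast
  obtain i where "i \<in> I"
    using index_nonempty[OF I] by blast
  then show "s = 0"
    using assms(3)[of i] T by simp
qed

text \<open>The vectors \<open>v i\<close> with \<open>i\<close> in the support of \<open>z\<close>
  span the whole space of dimension m + 1, because a linear form vanishing on all of them is a pair
  \<open>T\<close>, \<open>s\<close> as in \<open>weight_const_zero\<close>. A basis chosen among
  them gives the rows of the frame.\<close>

lemma ex_frame:
  assumes L: "L \<in> W" and z: "z \<in> S"
  obtains \<kappa> :: "'m option \<Rightarrow> 'n" where "inj \<kappa>" "\<And>\<alpha>. z $ \<kappa> \<alpha> \<noteq> 0" "det (frame \<kappa> L) \<noteq> 0"
proof -
  let ?I = "{i. z $ i \<noteq> 0}"
  have I: "?I \<in> \<I>"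
    using z by (simp add: S_def)
  define v :: "'n \<Rightarrow> complex ^ 'm option" where
    "v i = (\<chi> \<beta>. case \<beta> of Some j \<Rightarrow> L $ i $ j | None \<Rightarrow> 1)" for i
  obtain B where B: "B \<subseteq> v ` ?I" "vec.independent B" "v ` ?I \<subseteq> vec.span B"
    using vec.maximal_independent_subset by blast
  have finB: "finite B"
    using B(2) by (rule vec.finiteI_independent)
  have "card B \<le> CARD('m option)"
    using vec.dim_subset[of B UNIV] vec.dim_eq_card_independent[OF B(2)] by (simp only: subset_UNIV vec_dim_card)
  then obtain g :: "_ \<Rightarrow> 'm option" where g: "inj_on g B"
    using card_le_inj[OF finB, of "UNIV :: 'm option set"] by auto
  \<comment> \<open>At this point \<open>B\<close> might have fewer than m + 1 elements. Missing
    rows are filled with 0, and they are ruled out once the determinant is known to be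
    nonzero.\<close>
  define f where "f \<alpha> = (if \<alpha> \<in> g ` B then inv_into B g \<alpha> else 0)" for \<alpha>
  define A where "A = (\<chi> \<alpha>. f \<alpha>)"
  have fB: "f (g b) = b" if "b \<in> B" for b
    using that g by (simp add: f_def)
  have "x = 0" if x: "A *v x = 0" for x
  proof -
    let ?Z = "{v. (\<Sum>\<beta>\<in>UNIV. v $ \<beta> * x $ \<beta>) = 0}"
    have "vec.subspace ?Z"
      by (auto simp: vec.subspace_def ring_distribs sum.distrib mult.assoc simp flip: sum_distrib_left)
    moreover have "B \<subseteq> ?Z"
    proof
      fix b assume "b \<in> B"
      then have "A $ g b = b"
        by (simp add: A_def fB)
      moreover have "(A *v x) $ g b = 0"
        using x by simp
      ultimately show "b \<in> ?Z"
        by (simp add: matrix_vector_mult_def)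
    qed
    ultimately have "v ` ?I \<subseteq> ?Z"
      using B(3) vec.span_minimal by blast
    then have "weight L i (\<chi> j. x $ Some j) + x $ None = 0" if "i \<in> ?I" for i
      using that by (auto simp: v_def sum_option weight_def add.commute)
    from weight_const_zero[OF L I this] show "x = 0"
      by (simp add: vec_eq_iff) (metis option.exhaust)
  qed
  then have "\<exists>B. B ** A = mat 1"
    unfolding matrix_left_invertible_ker by blast
  then have detA: "det A \<noteq> 0"
    by (simp add: invertible_left_inverse flip: invertible_det_nz)
  have rowA: "row \<alpha> A = f \<alpha>" for \<alpha>
    by (simp add: row_def A_def vec_lambda_eta)
  have "f \<alpha> \<noteq> 0" for \<alpha>
    using detA det_zero_row(1)[of \<alpha> A] rowA by auto
  then have "f \<alpha> \<in> B" for \<alpha>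
    by (metis f_def inv_into_into)
  then have "f \<alpha> \<in> v ` ?I" for \<alpha>
    using B(1) by blast
  then have "\<forall>\<alpha>. \<exists>i. i \<in> ?I \<and> f \<alpha> = v i"
    unfolding image_iff Bex_def by blast
  then obtain \<kappa> where \<kappa>: "\<And>\<alpha>. \<kappa> \<alpha> \<in> ?I \<and> f \<alpha> = v (\<kappa> \<alpha>)"
    unfolding choice_iff by blast
  have "inj \<kappa>"
  proof (rule injI, rule ccontr)
    fix \<alpha> \<beta> assume "\<kappa> \<alpha> = \<kappa> \<beta>" "\<alpha> \<noteq> \<beta>"
    then have "row \<alpha> A = row \<beta> A"
      using \<kappa>[of \<alpha>] \<kappa>[of \<beta>] by (simp add: rowA)
    then show False
      using detA det_identical_rows[OF \<open>\<alpha> \<noteq> \<beta>\<close>] by blast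
  qed
  moreover have "frame \<kappa> L = A"
    using \<kappa> by (simp add: frame_def A_def v_def)
  ultimately show thesis
    using \<kappa> detA by (intro that[of \<kappa>]) auto
qed

end

text \<open>
  The slice through \<open>(L0, z0)\<close> fixes the coordinates with index in the range of \<open>\<kappa>\<close>; the others,
  numbered by \<open>\<delta>\<close>, are the fibre coordinates of the chart.
\<close>

locale lvm_slice = lvm_domain W \<I> r
  for W :: "((complex ^ 'm) ^ 'n) set" and \<I> r +
  fixes L0 :: "(complex ^ 'm) ^ 'n" and z0 :: "complex ^ 'n"
    and \<kappa> :: "'m option \<Rightarrow> 'n" and \<delta> :: "'d::finite \<Rightarrow> 'n"
  assumes L0: "L0 \<in> W" and z0: "z0 \<in> S" and z0_\<kappa>: "z0 $ \<kappa> \<alpha> \<noteq> 0"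
    and det_L0: "det (frame \<kappa> L0) \<noteq> 0"
    and \<delta>: "bij_betw \<delta> UNIV (- range \<kappa>)"
begin

definition coords :: "complex ^ 'n \<Rightarrow> complex ^ 'd" where
  "coords z = (\<chi> e. z $ \<delta> e)"

definition slice :: "complex ^ 'd \<Rightarrow> complex ^ 'n" where
  "slice w = (\<chi> j. if j \<in> range \<kappa> then z0 $ j else w $ (inv \<delta> j))"

lemma inj_\<delta>: "inj \<delta>" and \<delta>_notin: "\<delta> e \<notin> range \<kappa>" and \<delta>_surj: "j \<notin> range \<kappa> \<Longrightarrow> \<exists>e. j = \<delta> e"
  using \<delta> by (auto simp: bij_betw_def)

lemma coords_slice [simp]: "coords (slice w) = w"
  using \<delta>_notin inj_\<delta> by (simp add: coords_def slice_def vec_eq_iff)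

lemma slice_coords:
  assumes "\<And>\<alpha>. z $ \<kappa> \<alpha> = z0 $ \<kappa> \<alpha>"
  shows "slice (coords z) = z"
proof -
  have "slice (coords z) $ j = z $ j" for j
  proof (cases "j \<in> range \<kappa>")
    case False
    then obtain e where "j = \<delta> e"
      using \<delta>_surj by blast
    then show ?thesis
      using False inj_\<delta> by (auto simp: slice_def coords_def)
  qed (use assms in \<open>auto simp: slice_def\<close>)
  then show ?thesis
    by (simp add: vec_eq_iff)
qed

lemma slice_\<kappa> [simp]: "slice w $ \<kappa> \<alpha> = z0 $ \<kappa> \<alpha>"
  by (simp add: slice_def)

lemma slice_coords_z0 [simp]: "slice (coords z0) = z0"
  by (rule slice_coords) simp

lemma complex_diff_slice: "complex_diff w x \<Longrightarrow> complex_diff (\<lambda>x. slice (w x)) x"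
  unfolding slice_def
  by (intro complex_diff_vec_lambda complex_diff_if complex_diff_nth complex_diff_const)

lemma complex_diff_coords: "complex_diff z x \<Longrightarrow> complex_diff (\<lambda>x. coords (z x)) x"
  unfolding coords_def by (intro complex_diff_vec_lambda complex_diff_nth)

lemma continuous_slice:
  "continuous_on A (\<lambda>p :: ((complex ^ 'm) ^ 'n) \<times> (complex ^ 'd). (fst p, slice (snd p)))"
  by (intro continuous_at_imp_continuous_on ballI complex_diff_imp_isCont complex_diff_Pair
      complex_diff_slice complex_diff_fst complex_diff_snd complex_diff_ident)

text \<open>The parameters of a group element moving the coordinates \<kappa> \<alpha> of
  \<open>z\<close> to those of \<open>z0\<close>, by Cramer's formula. In this form holomorphy in
  both \<open>L\<close> and \<open>z\<close> can be read off from the entries.\<close>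

definition solution :: "(complex ^ 'm) ^ 'n \<Rightarrow> complex ^ 'n \<Rightarrow> complex ^ 'm option" where
  "solution L z = (\<chi> k. det (\<chi> i j. if j = k then Ln (z0 $ \<kappa> i / z $ \<kappa> i) else frame \<kappa> L $ i $ j)
     / det (frame \<kappa> L))"

lemma frame_solution:
  assumes "det (frame \<kappa> L) \<noteq> 0"
  shows "frame \<kappa> L *v x = (\<chi> \<alpha>. Ln (z0 $ \<kappa> \<alpha> / z $ \<kappa> \<alpha>)) \<longleftrightarrow> x = solution L z"
  using cramer[OF assms, of x "\<chi> \<alpha>. Ln (z0 $ \<kappa> \<alpha> / z $ \<kappa> \<alpha>)"] by (simp add: solution_def cong: if_cong)

definition retract :: "(complex ^ 'm) ^ 'n \<Rightarrow> complex ^ 'n \<Rightarrow> complex ^ 'n" where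
  "retract L z = cone_act L (\<chi> j. solution L z $ Some j) (solution L z $ None) z"

text \<open>The condition on real parts keeps the quotients of coordinates off the branch cut of
  \<open>Ln\<close>, so that \<open>solution\<close> is holomorphic here.\<close>

definition tube :: "(((complex ^ 'm) ^ 'n) \<times> (complex ^ 'n)) set" where
  "tube = {p \<in> W \<times> S. det (frame \<kappa> (fst p)) \<noteq> 0 \<and> (\<forall>\<alpha>. 0 < Re (snd p $ \<kappa> \<alpha> / z0 $ \<kappa> \<alpha>))}"

lemma isCont_det_frame: "isCont (\<lambda>L. det (frame \<kappa> L)) L"
  by (intro complex_diff_imp_isCont complex_diff_det complex_diff_frame complex_diff_ident)

lemma open_tube: "open tube"
proof -
  have "continuous_on UNIV (\<lambda>p::((complex ^ 'm) ^ 'n) \<times> (complex ^ 'n). det (frame \<kappa> (fst p)))"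
    by (intro continuous_at_imp_continuous_on ballI complex_diff_imp_isCont complex_diff_det
        complex_diff_frame complex_diff_fst complex_diff_ident)
  then have "open {p::((complex ^ 'm) ^ 'n) \<times> (complex ^ 'n). det (frame \<kappa> (fst p)) \<noteq> 0}"
    by (intro open_Collect_neq continuous_on_const)
  moreover have "open {p::((complex ^ 'm) ^ 'n) \<times> (complex ^ 'n). 0 < Re (snd p $ \<kappa> \<alpha> / z0 $ \<kappa> \<alpha>)}" for \<alpha>
    using z0_\<kappa> by (intro open_Collect_less continuous_intros) auto
  moreover have "tube = (W \<times> S) \<inter> {p. det (frame \<kappa> (fst p)) \<noteq> 0}
      \<inter> (\<Inter>\<alpha>. {p. 0 < Re (snd p $ \<kappa> \<alpha> / z0 $ \<kappa> \<alpha>)})"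
    by (auto simp: tube_def)
  ultimately show ?thesis
    using open_total by (auto intro!: open_Int open_INT)
qed

lemma tube_subset: "tube \<subseteq> W \<times> S"
  by (auto simp: tube_def)

lemma tube_\<kappa>:
  assumes "(L, z) \<in> tube"
  shows "z $ \<kappa> \<alpha> \<noteq> 0" "z0 $ \<kappa> \<alpha> / z $ \<kappa> \<alpha> \<notin> \<real>\<^sub>\<le>\<^sub>0"
proof -
  have re: "0 < Re (z $ \<kappa> \<alpha> / z0 $ \<kappa> \<alpha>)"
    using assms by (auto simp: tube_def)
  then show "z $ \<kappa> \<alpha> \<noteq> 0"
    by auto
  show "z0 $ \<kappa> \<alpha> / z $ \<kappa> \<alpha> \<notin> \<real>\<^sub>\<le>\<^sub>0"
  proof
    assume "z0 $ \<kappa> \<alpha> / z $ \<kappa> \<alpha> \<in> \<real>\<^sub>\<le>\<^sub>0"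
    then obtain c where "c \<le> 0" "z0 $ \<kappa> \<alpha> / z $ \<kappa> \<alpha> = of_real c"
      by (auto elim: nonpos_Reals_cases)
    then have "z $ \<kappa> \<alpha> / z0 $ \<kappa> \<alpha> = of_real (inverse c)"
      by (metis inverse_divide of_real_inverse)
    then have "0 < inverse c"
      using re by (simp only: Re_complex_of_real)
    then show False
      using \<open>c \<le> 0\<close> by simp
  qed
qed

lemma retract_\<kappa>:
  assumes "(L, z) \<in> tube"
  shows "retract L z $ \<kappa> \<alpha> = z0 $ \<kappa> \<alpha>"
proof -
  have "det (frame \<kappa> L) \<noteq> 0"
    using assms by (auto simp: tube_def)
  then have "frame \<kappa> L *v solution L z = (\<chi> \<alpha>. Ln (z0 $ \<kappa> \<alpha> / z $ \<kappa> \<alpha>))"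
    by (simp add: frame_solution)
  then have "weight L (\<kappa> \<alpha>) (\<chi> j. solution L z $ Some j) + solution L z $ None = Ln (z0 $ \<kappa> \<alpha> / z $ \<kappa> \<alpha>)"
    unfolding frame_mult_nth[symmetric] by simp
  then show ?thesis
    using tube_\<kappa>[OF assms] z0_\<kappa> by (simp add: retract_def)
qed

lemma retract_slice:
  assumes "(L, slice w) \<in> tube"
  shows "retract L (slice w) = slice w"
proof -
  have "det (frame \<kappa> L) \<noteq> 0"
    using assms by (auto simp: tube_def)
  moreover have "frame \<kappa> L *v 0 = (\<chi> \<alpha>. Ln (z0 $ \<kappa> \<alpha> / slice w $ \<kappa> \<alpha>))"
    using z0_\<kappa> by (simp add: vec_eq_iff)
  ultimately have "solution L (slice w) = 0"
    using frame_solution[of L 0 "slice w"] by simp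
  moreover have "(\<chi> j. 0) = (0 :: complex ^ 'm)"
    by (simp add: vec_eq_iff)
  ultimately show ?thesis
    by (simp add: retract_def)
qed

lemma complex_diff_retract:
  assumes "p \<in> tube"
  shows "complex_diff (\<lambda>p. retract (fst p) (snd p)) p"
proof -
  have p: "(fst p, snd p) \<in> tube"
    using assms by simp
  have det: "det (frame \<kappa> (fst p)) \<noteq> 0"
    using assms by (auto simp: tube_def)
  have "complex_diff (\<lambda>p. Ln (z0 $ \<kappa> i / snd p $ \<kappa> i)) p" for i
    using tube_\<kappa>[OF p]
    by (intro complex_diff_Ln complex_diff_divide complex_diff_nth complex_diff_snd
        complex_diff_const complex_diff_ident)
  then have "complex_diff (\<lambda>p. if j = k then Ln (z0 $ \<kappa> i / snd p $ \<kappa> i) else frame \<kappa> (fst p) $ i $ j) p" for i j k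
    by (intro complex_diff_if complex_diff_frame complex_diff_fst complex_diff_ident)
  then have "complex_diff (\<lambda>p. solution (fst p) (snd p)) p"
    unfolding solution_def using det
    by (intro complex_diff_vec_lambda complex_diff_divide complex_diff_det complex_diff_frame
        complex_diff_fst complex_diff_ident) auto
  then show ?thesis
    unfolding retract_def
    by (intro complex_diff_cone_act complex_diff_vec_lambda complex_diff_nth complex_diff_fst
        complex_diff_snd complex_diff_ident)
qed

lemma fam_proj_retract [simp]: "fam_proj (L, retract L z) = fam_proj (L, z)"
  by (simp add: retract_def)

definition slice_map :: "((complex ^ 'm) ^ 'n) \<times> (complex ^ 'd) \<Rightarrow> _" where
  "slice_map p = fam_proj (fst p, slice (snd p))"

text \<open>The chart before passing to the quotient. Constancy on orbits is not claimed for it;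
  that comes from the injectivity of \<open>slice_map\<close> near the base point.\<close>

definition chart_of :: "((complex ^ 'm) ^ 'n) \<times> (complex ^ 'n) \<Rightarrow> ((complex ^ 'm) ^ 'n) \<times> (complex ^ 'd)" where
  "chart_of p = (fst p, coords (retract (fst p) (snd p)))"

lemma complex_diff_chart_of: "p \<in> tube \<Longrightarrow> complex_diff chart_of p"
  unfolding chart_of_def
  by (intro complex_diff_Pair complex_diff_coords complex_diff_retract complex_diff_fst complex_diff_ident)

lemma slice_map_chart_of: "p \<in> tube \<Longrightarrow> slice_map (chart_of p) = fam_proj p"
  using slice_coords[OF retract_\<kappa>[of "fst p" "snd p"]] by (simp add: slice_map_def chart_of_def)

lemma chart_of_slice: "(L, slice w) \<in> tube \<Longrightarrow> chart_of (L, slice w) = (L, w)"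
  by (simp add: chart_of_def retract_slice)

text \<open>
  Two points of the slice that are close to the base point are related by group elements tending
  to the stabilizer of \<open>z0\<close>; up to periods it is trivial, and an element close to \<open>0\<close> that preserves
  the coordinates with index in the range of \<open>\<kappa>\<close> is \<open>0\<close>.
\<close>

lemma slice_map_locally_injective:
  obtains \<epsilon> where "\<epsilon> > 0" "inj_on slice_map (ball (L0, coords z0) \<epsilon>)"
proof (rule ccontr)
  note inj_thesis = that
  assume "\<not> thesis"
  then have notinj: "\<not> inj_on slice_map (ball (L0, coords z0) \<epsilon>)" if "\<epsilon> > 0" for \<epsilon>
    using inj_thesis that by blast
  let ?c = "(L0, coords z0)"
  obtain \<epsilon>0 where \<epsilon>0: "\<epsilon>0 > 0" "ball L0 \<epsilon>0 \<subseteq> W"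
    using open_W L0 by (meson openE)
  \<comment> \<open>Capping the radius by \<epsilon>0 keeps the configurations in \<open>W\<close>,
    as \<open>cone_act_subseq\<close> requires.\<close>
  let ?e = "\<lambda>k. min \<epsilon>0 (inverse (real (Suc k)))"
  have "\<forall>k. \<exists>u v. u \<in> ball ?c (?e k) \<and> v \<in> ball ?c (?e k) \<and> slice_map u = slice_map v \<and> u \<noteq> v"
    using notinj[of "?e _"] \<epsilon>0(1) unfolding inj_on_def by (metis inverse_positive_iff_positive min_less_iff_conj of_nat_0_less_iff zero_less_Suc)
  then obtain u v where uv: "\<And>k. u k \<in> ball ?c (?e k)" "\<And>k. v k \<in> ball ?c (?e k)"
    "\<And>k. slice_map (u k) = slice_map (v k)" "\<And>k. u k \<noteq> v k"
    by metis
  have lim: "w \<longlonglongrightarrow> ?c" if "\<And>k. w k \<in> ball ?c (?e k)" for w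
  proof -
    have "norm (dist (w k) ?c) \<le> inverse (real (Suc k))" for k
      using that[of k] by (simp add: dist_commute)
    then have "(\<lambda>k. dist (w k) ?c) \<longlonglongrightarrow> 0"
      by (intro Lim_null_comparison[OF _ LIMSEQ_inverse_real_of_nat]) auto
    then show ?thesis
      by (simp add: tendsto_dist_iff[of w ?c])
  qed
  have u: "u \<longlonglongrightarrow> ?c" and v: "v \<longlonglongrightarrow> ?c"
    using lim uv by blast+
  have fst_eq: "fst (v k) = fst (u k)" for k
    using arg_cong[OF uv(3)[of k], of fst] by (simp add: slice_map_def)
  have cont: "(\<lambda>k. slice (snd (w k))) \<longlonglongrightarrow> z0" if "w \<longlonglongrightarrow> ?c" for w
  proof -
    have "isCont slice (coords z0)"
      by (intro complex_diff_imp_isCont complex_diff_slice complex_diff_ident)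
    from isCont_tendsto_compose[OF this tendsto_snd[OF that, simplified]] show ?thesis
      by simp
  qed
  have "\<exists>T s. \<bar>Im s\<bar> \<le> pi \<and> slice (snd (v k)) = cone_act (fst (u k)) T s (slice (snd (u k)))" for k
  proof -
    obtain T s where "slice (snd (v k)) = cone_act (fst (u k)) T s (slice (snd (u k)))"
      using uv(3)[of k] by (auto simp: slice_map_def fam_proj_eq_iff)
    then show ?thesis
      using cone_act_reduce[where s = s and L = "fst (u k)" and T = T] by metis
  qed
  then obtain T s where Ts: "\<And>k. \<bar>Im (s k)\<bar> \<le> pi"
    "\<And>k. slice (snd (v k)) = cone_act (fst (u k)) (T k) (s k) (slice (snd (u k)))"
    by metis
  have fst_u: "(\<lambda>k. fst (u k)) \<longlonglongrightarrow> L0"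
    using tendsto_fst[OF u] by simp
  have u_W: "fst (u k) \<in> W" for k
  proof -
    have "dist L0 (fst (u k)) \<le> dist ?c (u k)"
      by (metis dist_fst_le fst_conv)
    then show ?thesis
      using uv(1)[of k] \<epsilon>0(2) by auto
  qed
  have v_lim: "(\<lambda>k. cone_act (fst (u k)) (T k) (s k) (slice (snd (u k)))) \<longlonglongrightarrow> z0"
    using cont[OF v] by (simp add: Ts(2))
  obtain T0 s0 \<phi> where \<phi>: "strict_mono \<phi>" "(T \<circ> \<phi>) \<longlonglongrightarrow> T0" "(s \<circ> \<phi>) \<longlonglongrightarrow> s0"
    "z0 = cone_act L0 T0 s0 z0" "\<bar>Im s0\<bar> \<le> pi"
    using cone_act_subseq[OF u_W fst_u cont[OF u] v_lim z0 z0 Ts(1)] by blast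
  have "T0 = 0" "s0 = 0"
    using cone_act_fixed[OF L0 z0 \<phi>(4)[symmetric] \<phi>(5)] by auto
  then have T: "(\<lambda>k. T (\<phi> k)) \<longlonglongrightarrow> 0" and s: "(\<lambda>k. s (\<phi> k)) \<longlonglongrightarrow> 0"
    using \<phi> by (auto simp: o_def)
  have L: "(\<lambda>k. fst (u (\<phi> k))) \<longlonglongrightarrow> L0"
    using LIMSEQ_subseq_LIMSEQ[OF fst_u \<phi>(1)] by (simp add: o_def)
  have "(\<lambda>k. weight (fst (u (\<phi> k))) i (T (\<phi> k)) + s (\<phi> k)) \<longlonglongrightarrow> weight L0 i 0 + 0" for i
    unfolding weight_def by (intro tendsto_intros L T s)
  then have "(\<lambda>k. norm (weight (fst (u (\<phi> k))) i (T (\<phi> k)) + s (\<phi> k))) \<longlonglongrightarrow> 0" for i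
    by (simp add: tendsto_norm_zero)
  then have "\<forall>\<^sub>F k in sequentially. norm (weight (fst (u (\<phi> k))) i (T (\<phi> k)) + s (\<phi> k)) < 2 * pi" for i
    by (rule order_tendstoD) simp
  then have "\<forall>\<^sub>F k in sequentially. \<forall>i. norm (weight (fst (u (\<phi> k))) i (T (\<phi> k)) + s (\<phi> k)) < 2 * pi"
    by (simp add: eventually_all_finite)
  moreover have "\<forall>\<^sub>F k in sequentially. det (frame \<kappa> (fst (u (\<phi> k)))) \<noteq> 0"
    using isCont_tendsto_compose[OF isCont_det_frame L] det_L0 by (rule tendsto_imp_eventually_ne)
  ultimately have "\<forall>\<^sub>F k in sequentially. (\<forall>i. norm (weight (fst (u (\<phi> k))) i (T (\<phi> k)) + s (\<phi> k)) < 2 * pi)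
      \<and> det (frame \<kappa> (fst (u (\<phi> k)))) \<noteq> 0"
    by (rule eventually_conj)
  then obtain k where k: "\<And>i. norm (weight (fst (u (\<phi> k))) i (T (\<phi> k)) + s (\<phi> k)) < 2 * pi"
    "det (frame \<kappa> (fst (u (\<phi> k)))) \<noteq> 0"
    by (auto simp: eventually_sequentially)
  let ?k = "\<phi> k"
  define x :: "complex ^ 'm option" where "x = (\<chi> \<beta>. case \<beta> of Some j \<Rightarrow> T ?k $ j | None \<Rightarrow> s ?k)"
  have x: "(\<chi> j. x $ Some j) = T ?k" "x $ None = s ?k"
    by (simp_all add: x_def vec_eq_iff)
  have "weight (fst (u ?k)) (\<kappa> \<alpha>) (T ?k) + s ?k = 0" for \<alpha>
  proof -
    let ?w = "weight (fst (u ?k)) (\<kappa> \<alpha>) (T ?k) + s ?k"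
    have "z0 $ \<kappa> \<alpha> = z0 $ \<kappa> \<alpha> * exp ?w"
      using arg_cong[OF Ts(2)[of ?k], of "\<lambda>z. z $ \<kappa> \<alpha>"] by simp
    then have "exp ?w = 1"
      using z0_\<kappa>[of \<alpha>] by simp
    then obtain n :: int where n: "Re ?w = 0" "Im ?w = of_int (2 * n) * pi"
      by (auto simp: exp_eq_1)
    have "\<bar>of_int n * (2 * pi)\<bar> < 1 * (2 * pi)"
      using k(1)[of "\<kappa> \<alpha>"] abs_Im_le_cmod[of ?w] n(2) by (simp add: mult_ac)
    then have "\<bar>real_of_int n\<bar> < 1"
      unfolding abs_mult by (simp add: mult_less_cancel_right)
    then have "n = 0"
      by linarith
    then show ?thesis
      using n by (simp add: complex_eq_iff)
  qed
  then have "frame \<kappa> (fst (u ?k)) *v x = 0"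
    by (simp add: vec_eq_iff frame_mult_nth x)
  then have "x = 0"
    using k(2) matrix_left_invertible_ker[of "frame \<kappa> (fst (u ?k))"]
    by (metis invertible_det_nz invertible_left_inverse)
  then have "T ?k = 0" "s ?k = 0"
    using x by (auto simp: vec_eq_iff)
  then have "slice (snd (v ?k)) = slice (snd (u ?k))"
    using Ts(2)[of ?k] by simp
  then have "snd (v ?k) = snd (u ?k)"
    by (metis coords_slice)
  then show False
    using uv(4)[of ?k] fst_eq[of ?k] by (simp add: prod_eq_iff)
qed

end

section \<open>Charts of the total space\<close>

context lvm_slice
begin

text \<open>The chart inverts \<open>slice_map\<close> on a ball where it is injective. Besides what
  a holomorphic family asks for, the explicit parametrisation by the slice is exported: it is needed
  again to extend functions from a single fibre.\<close>

lemma ex_chart: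
  obtains A :: "(((complex ^ 'm) ^ 'n) \<times> (complex ^ 'n) set set) set"
    and B :: "(((complex ^ 'm) ^ 'n) \<times> (complex ^ 'd)) set" and \<phi>
  where "openin (cs_top E) A" "fam_proj (L0, z0) \<in> A" "open B"
    "biholomorphic_map (cs_restrict E A) (open_cspace B) \<phi>"
    "\<And>p. p \<in> B \<Longrightarrow> (fst p, slice (snd p)) \<in> W \<times> S"
    "A = slice_map ` B" "\<And>p. p \<in> B \<Longrightarrow> \<phi> (slice_map p) = p"
proof -
  obtain \<epsilon> where \<epsilon>: "\<epsilon> > 0" "inj_on slice_map (ball (L0, coords z0) \<epsilon>)"
    by (rule slice_map_locally_injective)
  define B where "B = ball (L0, coords z0) \<epsilon> \<inter> {p. (fst p, slice (snd p)) \<in> tube}"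
  define A where "A = slice_map ` B"
  define \<phi> where "\<phi> = the_inv_into B slice_map"
  have B_tube: "(fst p, slice (snd p)) \<in> tube" if "p \<in> B" for p
    using that by (auto simp: B_def)
  have B_WS: "(fst p, slice (snd p)) \<in> W \<times> S" if "p \<in> B" for p
    using B_tube[OF that] tube_subset by blast
  have inj: "inj_on slice_map B"
    using \<epsilon>(2) by (rule inj_on_subset) (auto simp: B_def)
  have \<phi>: "\<phi> (slice_map p) = p" if "p \<in> B" for p
    using inj that by (simp add: \<phi>_def the_inv_into_f_f)
  have "open {p::((complex ^ 'm) ^ 'n) \<times> (complex ^ 'd). (fst p, slice (snd p)) \<in> tube}"
    using open_vimage[OF open_tube continuous_slice[of UNIV]] by (simp add: vimage_def)
  then have open_B: "open B"
    unfolding B_def by (intro open_Int open_ball)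

  have "(L0, z0) \<in> tube"
    using L0 z0 det_L0 z0_\<kappa> by (auto simp: tube_def)
  then have base: "(L0, coords z0) \<in> B"
    using \<epsilon>(1) by (simp add: B_def)
  then have base_A: "fam_proj (L0, z0) \<in> A"
    unfolding A_def by (intro image_eqI[of _ _ "(L0, coords z0)"]) (auto simp: slice_map_def)
  have chart_of_slice': "chart_of (fst p, slice (snd p)) = p" if "p \<in> B" for p
    using chart_of_slice[OF B_tube[OF that]] by simp
  have cont_chart: "continuous_on tube chart_of"
    by (intro continuous_at_imp_continuous_on ballI complex_diff_imp_isCont complex_diff_chart_of)
  have open_image: "openin (cs_top E) (slice_map ` V)" if V: "open V" "V \<subseteq> B" for V
  proof -
    \<comment> \<open>The slice has positive codimension in the total space upstairs, so its open
      subsets are thickened inside the tube; this does not change their images in the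
      quotient.\<close>
    have "slice_map ` V = fam_proj ` (tube \<inter> chart_of -` V)"
    proof (intro equalityI subsetI)
      fix x assume "x \<in> slice_map ` V"
      then obtain p where p: "p \<in> V" "x = slice_map p" by auto
      then have "p \<in> B"
        using V(2) by blast
      then show "x \<in> fam_proj ` (tube \<inter> chart_of -` V)"
        using p chart_of_slice'[of p] B_tube[of p] by (auto simp: slice_map_def intro!: imageI)
    next
      fix x assume "x \<in> fam_proj ` (tube \<inter> chart_of -` V)"
      then obtain y where y: "y \<in> tube" "chart_of y \<in> V" "x = fam_proj y" by auto
      then show "x \<in> slice_map ` V"
        using slice_map_chart_of[of y] by (metis imageI)
    qed
    moreover have "open (tube \<inter> chart_of -` V)"
      using continuous_open_preimage[OF cont_chart open_tube V(1)] by simp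
    ultimately show ?thesis
      using openin_fam_proj[of "tube \<inter> chart_of -` V"] tube_subset by auto
  qed
  have open_A: "openin (cs_top E) A"
    unfolding A_def using open_image[OF open_B] by simp
  have A_sub: "A \<subseteq> cs_points E"
    using openin_subset[OF open_A] .
  have pre: "{x \<in> A. \<phi> x \<in> V} = slice_map ` V" if "V \<subseteq> B" for V
    using that \<phi> by (auto simp: A_def)
  have cont_slice_map: "continuous_map (top_of_set B) (cs_top E) slice_map"
  proof -
    have "continuous_map (top_of_set B) (top_of_set (W \<times> S)) (\<lambda>p. (fst p, slice (snd p)))"
      using continuous_slice[of B] B_WS by (auto simp: continuous_map_in_subtopology)
    from continuous_map_compose[OF this quotient_imp_continuous_map[OF quotient_map_E]]
    show ?thesis
      by (simp add: o_def slice_map_def[abs_def])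
  qed
  have "homeomorphic_maps (subtopology (cs_top E) A) (top_of_set B) \<phi> slice_map"
    unfolding homeomorphic_maps_def
  proof (intro conjI ballI)
    show "continuous_map (subtopology (cs_top E) A) (top_of_set B) \<phi>"
      unfolding continuous_map
    proof (intro conjI allI impI)
      show "\<phi> ` topspace (subtopology (cs_top E) A) \<subseteq> topspace (top_of_set B)"
        using \<phi> by (auto simp: A_def)
      fix V assume "openin (top_of_set B) V"
      then have V: "open V" "V \<subseteq> B"
        by (auto simp: openin_open_eq[OF open_B])
      have eq: "{x \<in> topspace (subtopology (cs_top E) A). \<phi> x \<in> V} = slice_map ` V"
        using pre[OF V(2)] A_sub by auto
      show "openin (subtopology (cs_top E) A) {x \<in> topspace (subtopology (cs_top E) A). \<phi> x \<in> V}"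
        unfolding eq openin_open_subtopology[OF open_A]
        using open_image[OF V] V(2) by (auto simp: A_def)
    qed
    show "continuous_map (top_of_set B) (subtopology (cs_top E) A) slice_map"
      using cont_slice_map by (auto simp: continuous_map_in_subtopology A_def)
  qed (use \<phi> in \<open>auto simp: A_def\<close>)
  then have homeo: "homeomorphic_map (cs_top (cs_restrict E A)) (cs_top (open_cspace B)) \<phi>"
    by (auto simp: homeomorphic_map_maps cs_restrict_def open_cspace_def)
  have hol: "holomorphic_several V f \<longleftrightarrow> cs_hol E (slice_map ` V) (f \<circ> \<phi>)"
    if V: "open V" "V \<subseteq> B" for V and f
    unfolding holomorphic_several_iff hol_E
  proof (intro iffI ballI impI)
    fix p assume *: "\<forall>x\<in>W \<times> S. fam_proj x \<in> slice_map ` V \<longrightarrow> complex_diff (f \<circ> \<phi> \<circ> fam_proj) x"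
      and p: "p \<in> V"
    then have "p \<in> B"
      using V(2) by blast
    have "complex_diff (f \<circ> \<phi> \<circ> fam_proj) (fst p, slice (snd p))"
      using *[rule_format, OF B_WS[OF \<open>p \<in> B\<close>]] p by (auto simp: slice_map_def)
    then have "complex_diff (\<lambda>p. (f \<circ> \<phi> \<circ> fam_proj) (fst p, slice (snd p))) p"
      by (intro complex_diff_compose[of "\<lambda>p. (fst p, slice (snd p))" p "f \<circ> \<phi> \<circ> fam_proj"]
          complex_diff_Pair complex_diff_slice complex_diff_fst complex_diff_snd complex_diff_ident) auto
    then show "complex_diff f p"
      by (rule complex_diff_transform[OF _ V(1) p])
        (use V(2) \<phi> in \<open>auto simp: slice_map_def[symmetric]\<close>)
  next
    fix y assume *: "\<forall>p\<in>V. complex_diff f p" and y: "y \<in> W \<times> S" "fam_proj y \<in> slice_map ` V"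
    then obtain p where p: "p \<in> V" "fam_proj y = slice_map p" by auto
    have pB: "p \<in> B"
      using p(1) V(2) by blast
    \<comment> \<open>The point \<open>y\<close> need not lie in the tube, but one fixed group
      element carries it onto the slice. Near \<open>y\<close> the pulled-back function is therefore
      \<open>f\<close> after \<open>chart_of\<close> after this translation.\<close>
    obtain T s where Ts: "fst y = fst p" "slice (snd p) = cone_act (fst y) T s (snd y)"
      using p(2) fam_proj_eq_iff[of "fst y" "snd y" "fst p" "slice (snd p)"] by (auto simp: slice_map_def)
    define g where "g y = (fst y, cone_act (fst y) T s (snd y))" for y :: "((complex ^ 'm) ^ 'n) \<times> (complex ^ 'n)"
    have g: "complex_diff g y" for y
      unfolding g_def
      by (intro complex_diff_Pair complex_diff_cone_act complex_diff_fst complex_diff_snd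
          complex_diff_ident complex_diff_const)
    then have "continuous_on UNIV g"
      by (intro continuous_at_imp_continuous_on ballI complex_diff_imp_isCont)
    have fg: "fam_proj (g y) = fam_proj y" for y
      by (simp add: g_def)
    have gy: "g y = (fst p, slice (snd p))"
      using Ts by (simp add: g_def)
    define D where "D = g -` (tube \<inter> chart_of -` V)"
    have "open D"
      unfolding D_def
      using continuous_open_preimage[OF cont_chart open_tube V(1)]
      by (intro open_vimage \<open>continuous_on UNIV g\<close>) auto
    moreover have "y \<in> D"
      using gy p(1) chart_of_slice'[OF pB] B_tube[OF pB] by (simp add: D_def)
    moreover have "f (chart_of (g y')) = (f \<circ> \<phi> \<circ> fam_proj) y'" if "y' \<in> D" for y'
    proof -
      have "slice_map (chart_of (g y')) = fam_proj y'"
        using that slice_map_chart_of[of "g y'"] fg by (simp add: D_def)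
      moreover have "chart_of (g y') \<in> B"
        using that V(2) by (auto simp: D_def)
      ultimately show ?thesis
        using \<phi> by (metis comp_apply)
    qed
    moreover have "complex_diff (\<lambda>y'. f (chart_of (g y'))) y"
      using * p(1) gy chart_of_slice'[OF pB] B_tube[OF pB]
      by (intro complex_diff_compose[of "\<lambda>y. chart_of (g y)" y f] complex_diff_compose[of g y chart_of]
          g complex_diff_chart_of) auto
    ultimately show "complex_diff (f \<circ> \<phi> \<circ> fam_proj) y"
      using complex_diff_transform[of "\<lambda>y'. f (chart_of (g y'))" y D "f \<circ> \<phi> \<circ> fam_proj"] by blast
  qed
  have "biholomorphic_map (cs_restrict E A) (open_cspace B) \<phi>"
    unfolding biholomorphic_map_def
  proof (intro conjI allI impI homeo)
    fix V f assume "openin (cs_top (open_cspace B)) V"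
    then have V: "open V" "V \<subseteq> B"
      by (auto simp: open_cspace_def openin_open_eq[OF open_B])
    have "{x \<in> cs_points (cs_restrict E A). \<phi> x \<in> V} = slice_map ` V"
      using pre[OF V(2)] A_sub by (auto simp: cs_restrict_def)
    then show "cs_hol (open_cspace B) V f \<longleftrightarrow>
        cs_hol (cs_restrict E A) {x \<in> cs_points (cs_restrict E A). \<phi> x \<in> V} (f \<circ> \<phi>)"
      using hol[OF V, of f] by (simp add: cs_restrict_def open_cspace_def)
  qed
  then show thesis
    using that[of A B \<phi>] open_A base_A open_B B_WS A_def \<phi> by blast
qed

end

context lvm_domain
begin

text \<open>Freezing m + 1 coordinates leaves n - m - 1, the cardinality of \<open>'d\<close>, to be
  numbered by \<delta>. Of the slice only a holomorphic section \<iota> is remembered, independent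
  of the base point chosen for it.\<close>

lemma ex_chart_at:
  fixes x :: "((complex ^ 'm) ^ 'n) \<times> (complex ^ 'n) set set"
  assumes d: "CARD('d::finite) = CARD('n) - CARD('m) - 1"
    and x: "x \<in> cs_points E"
  obtains A and B :: "(((complex ^ 'm) ^ 'n) \<times> (complex ^ 'd)) set" and \<phi> and \<iota> :: "complex ^ 'd \<Rightarrow> complex ^ 'n"
  where "openin (cs_top E) A" "x \<in> A" "open B"
    "biholomorphic_map (cs_restrict E A) (open_cspace B) \<phi>"
    "\<And>p. p \<in> B \<Longrightarrow> (fst p, \<iota> (snd p)) \<in> W \<times> S"
    "A = (\<lambda>p. fam_proj (fst p, \<iota> (snd p))) ` B"
    "\<And>p. p \<in> B \<Longrightarrow> \<phi> (fam_proj (fst p, \<iota> (snd p))) = p"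
    "\<And>w. complex_diff \<iota> w"
proof -
  obtain L0 z0 where L0: "L0 \<in> W" and z0: "z0 \<in> S" and x0: "x = fam_proj (L0, z0)"
    using x by (auto simp: points_E)
  obtain \<kappa> :: "'m option \<Rightarrow> 'n" where \<kappa>: "inj \<kappa>" "\<And>\<alpha>. z0 $ \<kappa> \<alpha> \<noteq> 0" "det (frame \<kappa> L0) \<noteq> 0"
    using ex_frame[OF L0 z0] by blast
  have "card (range \<kappa>) = CARD('m) + 1"
    using \<kappa>(1) by (simp add: card_image)
  then have "card (- range \<kappa>) = CARD('d)"
    using d by (simp add: Compl_eq_Diff_UNIV card_Diff_subset)
  then obtain \<delta> :: "'d \<Rightarrow> 'n" where \<delta>: "bij_betw \<delta> UNIV (- range \<kappa>)"
    using finite_same_card_bij[of "UNIV :: 'd set" "- range \<kappa>"] by auto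
  interpret lvm_slice W \<I> r L0 z0 \<kappa> \<delta>
    using L0 z0 \<kappa> \<delta> by unfold_locales auto
  show thesis
  proof (rule ex_chart)
    fix A B \<phi>
    assume *: "openin (cs_top E) A" "fam_proj (L0, z0) \<in> A" "open B"
      "biholomorphic_map (cs_restrict E A) (open_cspace B) \<phi>"
      "\<And>p. p \<in> B \<Longrightarrow> (fst p, slice (snd p)) \<in> W \<times> S"
      "A = slice_map ` B" "\<And>p. p \<in> B \<Longrightarrow> \<phi> (slice_map p) = p"
    show thesis
      using * complex_diff_slice[OF complex_diff_ident]
      by (intro that[of A B \<phi> slice]) (auto simp: x0 slice_map_def[abs_def])
  qed
qed

lemma holomorphic_family_E:
  assumes d: "CARD('d::finite) = CARD('n) - CARD('m) - 1"
    and S: "S \<noteq> {}"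
  shows "holomorphic_family TYPE('d) E fst W"
  unfolding holomorphic_family_def
proof (intro conjI ballI)
  show "fst ` cs_points E = W"
    using S by (simp add: points_E image_image)
  fix x assume "x \<in> cs_points E"
  then show "\<exists>A (B :: (((complex ^ 'm) ^ 'n) \<times> (complex ^ 'd)) set) \<phi>.
      openin (cs_top E) A \<and> x \<in> A \<and> open B \<and>
      biholomorphic_map (cs_restrict E A) (open_cspace B) \<phi> \<and> (\<forall>y\<in>A. fst (\<phi> y) = fst y)"
  proof (rule ex_chart_at[OF d])
    fix A and B :: "(((complex ^ 'm) ^ 'n) \<times> (complex ^ 'd)) set" and \<phi> \<iota>
    assume *: "openin (cs_top E) A" "x \<in> A" "open B"
      "biholomorphic_map (cs_restrict E A) (open_cspace B) \<phi>"
      "A = (\<lambda>p. fam_proj (fst p, \<iota> (snd p))) ` B"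
      "\<And>p. p \<in> B \<Longrightarrow> \<phi> (fam_proj (fst p, \<iota> (snd p))) = p"
    have "\<forall>y\<in>A. fst (\<phi> y) = fst y"
      using *(5,6) by auto
    then show ?thesis
      using *(1-4) by blast
  qed
qed (use open_W Hausdorff_E second_countable_E proper_E in auto)

end

section \<open>Fibres of the family\<close>

context lvm_domain
begin

lemma proj_point_saturated:
  assumes "proj_point z = proj_point z'"
  shows "z \<in> S \<longleftrightarrow> z' \<in> S"
proof -
  \<comment> \<open>Any configuration will do, since weights vanish at 0.\<close>
  obtain s where "z' = cone_act (undefined :: (complex ^ 'm) ^ 'n) 0 s z"
    using assms proj_point_eq_iff by blast
  then show ?thesis
    by (simp del: cone_act_nth)
qed

text \<open>Restricting projective space to the image of \<open>S\<close> is harmless because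
  \<open>S\<close> is open and a union of punctured lines.\<close>

lemma openin_V_space:
  assumes "L \<in> W"
  shows "openin (cs_top (V_space L)) Q \<longleftrightarrow> Q \<subseteq> proj_point ` S \<and> open {z \<in> S. proj_point z \<in> Q}"
proof -
  have openin_ps: "openin (cs_top projective_space) Q \<longleftrightarrow>
      Q \<subseteq> proj_point ` (- {0}) \<and> open {z \<in> - {0}. proj_point z \<in> Q}"
    for Q :: "(complex ^ 'n) set set"
  proof -
    have "open (- {0 :: complex ^ 'n})"
      by auto
    from openin_open_eq[OF this] show ?thesis
      unfolding projective_space_def openin_cs_quotient by (auto simp: open_cspace_def)
  qed
  have eq: "{z. z \<noteq> 0 \<and> proj_point z \<in> Q} = {z \<in> S. proj_point z \<in> Q}" if "Q \<subseteq> proj_point ` S" for Q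
  proof -
    have "z \<in> S" if "proj_point z \<in> Q" for z
      using \<open>Q \<subseteq> proj_point ` S\<close> that proj_point_saturated by blast
    then show ?thesis
      using zero_notin_S by auto
  qed
  have "{z \<in> S. proj_point z \<in> proj_point ` S} = S"
    by auto
  then have "openin (cs_top projective_space) (proj_point ` S)"
    using open_S zero_notin_S by (auto simp: openin_ps eq)
  then have "openin (cs_top (V_space L)) Q \<longleftrightarrow> openin (cs_top projective_space) Q \<and> Q \<subseteq> proj_point ` S"
    by (simp add: V_space_def cs_restrict_def siegel_points_eq[OF assms] openin_open_subtopology)
  also have "\<dots> \<longleftrightarrow> Q \<subseteq> proj_point ` S \<and> open {z \<in> S. proj_point z \<in> Q}"
    using zero_notin_S by (auto simp: openin_ps eq)
  finally show ?thesis .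
qed

lemma points_V_space:
  assumes "L \<in> W"
  shows "cs_points (V_space L) = proj_point ` S"
proof
  show "cs_points (V_space L) \<subseteq> proj_point ` S"
    using openin_V_space[OF assms] by blast
  have "{z \<in> S. proj_point z \<in> proj_point ` S} = S"
    by auto
  then show "proj_point ` S \<subseteq> cs_points (V_space L)"
    using openin_V_space[OF assms, of "proj_point ` S"] open_S by (intro openin_subset) auto
qed

text \<open>The two-stage quotient is described directly on \<open>S\<close>, where it can be
  compared with the family.\<close>

lemma openin_LVM:
  assumes "L \<in> W"
  shows "openin (cs_top (LVM L)) U \<longleftrightarrow>
    U \<subseteq> (\<lambda>z. lvm_orbit L (proj_point z)) ` S \<and> open {z \<in> S. lvm_orbit L (proj_point z) \<in> U}"
proof -
  have "{z \<in> S. proj_point z \<in> {p \<in> proj_point ` S. lvm_orbit L p \<in> U}} = {z \<in> S. lvm_orbit L (proj_point z) \<in> U}"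
    by auto
  then show ?thesis
    unfolding LVM_def openin_cs_quotient points_V_space[OF assms] openin_V_space[OF assms] image_image
    by auto
qed

lemma points_LVM:
  assumes "L \<in> W"
  shows "cs_points (LVM L) = (\<lambda>z. lvm_orbit L (proj_point z)) ` S"
proof -
  have "cs_points (LVM L) = lvm_orbit L ` cs_points (V_space L)"
    unfolding LVM_def by (rule quotient_imp_surjective_map[OF quotient_map_cs_quotient, symmetric])
  then show ?thesis
    by (simp only: points_V_space[OF assms] image_image)
qed

lemma hol_LVM:
  assumes "L \<in> W"
  shows "cs_hol (LVM L) U f \<longleftrightarrow>
    (\<forall>z\<in>S. lvm_orbit L (proj_point z) \<in> U \<longrightarrow> complex_diff (\<lambda>z. f (lvm_orbit L (proj_point z))) z)"
proof -
  have eq: "{z \<in> - {0}. proj_point z \<in> {p \<in> proj_point ` S. lvm_orbit L p \<in> U}}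
      = {z \<in> S. lvm_orbit L (proj_point z) \<in> U}"
  proof -
    have "proj_point z \<in> proj_point ` S \<longleftrightarrow> z \<in> S" for z
      using proj_point_saturated by blast
    moreover have "z \<in> S \<Longrightarrow> z \<noteq> 0" for z
      using zero_notin_S by metis
    ultimately show ?thesis
      by (intro Collect_cong) (simp, metis)
  qed
  show ?thesis
    unfolding LVM_def cs_quotient_def cspace.select_convs points_V_space[OF assms]
    unfolding V_space_def cs_restrict_def cspace.select_convs projective_space_def cs_quotient_def
    unfolding open_cspace_def cspace.select_convs topspace_euclidean_subtopology eq holomorphic_several_iff
    by (auto simp: o_def)
qed

text \<open>The map is \<open>Pair L\<close>. The substantial direction is that a holomorphic
  function on \<open>LVM L\<close> is locally the restriction of one on the total space; a chart
  splits off the base, and the extension ignores the base coordinate.\<close>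

lemma biholomorphic_fibre:
  assumes L: "L \<in> W" and d: "CARD('d::finite) = CARD('n) - CARD('m) - 1"
  shows "biholomorphic (LVM L) (cs_fibre E fst L)"
proof -
  let ?q = "\<lambda>z. lvm_orbit L (proj_point z)"
  let ?Y = "{x \<in> cs_points E. fst x = L}"
  have q: "fam_proj (L, z) = (L, ?q z)" for z
    by (simp add: fam_proj_def)
  have Y: "?Y = Pair L ` ?q ` S"
  proof (intro equalityI subsetI)
    fix x assume "x \<in> ?Y"
    then obtain p where "p \<in> W \<times> S" "x = fam_proj p" "fst p = L"
      by (auto simp: points_E)
    then show "x \<in> Pair L ` ?q ` S"
      by (auto simp: fam_proj_def)
  next
    fix x assume "x \<in> Pair L ` ?q ` S"
    then obtain z where z: "z \<in> S" "x = fam_proj (L, z)"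
      by (auto simp: q)
    then have "x \<in> fam_proj ` (W \<times> S)"
      using L by blast
    then show "x \<in> ?Y"
      using z(2) by (simp add: points_E)
  qed
  have topF: "cs_top (cs_fibre E fst L) = subtopology (cs_top E) ?Y"
    by (simp add: cs_fibre_def)
  have pointsF: "cs_points (cs_fibre E fst L) = ?Y"
    by (auto simp: topF)
  have slice_open: "open {z \<in> S. (L, ?q z) \<in> A}" if "openin (cs_top E) A" for A
  proof -
    have "open {x \<in> W \<times> S. fam_proj x \<in> A}"
      using that by (simp add: openin_E)
    from open_vimage[OF this, of "Pair L"] show ?thesis
      using L by (simp add: vimage_def q continuous_on_Pair)
  qed
  have openF: "\<exists>A. openin (cs_top E) A \<and> V = A \<inter> ?Y" if "openin (cs_top (cs_fibre E fst L)) V" for V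
    using that by (auto simp: topF openin_subtopology)
  have openF': "open {z \<in> S. (L, ?q z) \<in> V}" if V: "openin (cs_top (cs_fibre E fst L)) V" for V
  proof -
    obtain A where A: "openin (cs_top E) A" "V = A \<inter> ?Y"
      using openF[OF V] by blast
    have "{z \<in> S. (L, ?q z) \<in> V} = {z \<in> S. (L, ?q z) \<in> A}"
      unfolding A(2) Y by auto
    then show ?thesis
      using slice_open[OF A(1)] by simp
  qed
  have cont: "continuous_map (cs_top (LVM L)) (cs_top (cs_fibre E fst L)) (Pair L)"
    unfolding continuous_map
  proof (intro conjI allI impI)
    show "Pair L ` cs_points (LVM L) \<subseteq> cs_points (cs_fibre E fst L)"
      by (simp add: pointsF Y points_LVM[OF L])
    fix V assume V: "openin (cs_top (cs_fibre E fst L)) V"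
    have "{z \<in> S. ?q z \<in> {x \<in> cs_points (LVM L). (L, x) \<in> V}} = {z \<in> S. (L, ?q z) \<in> V}"
      by (auto simp: points_LVM[OF L])
    then show "openin (cs_top (LVM L)) {x \<in> cs_points (LVM L). (L, x) \<in> V}"
      using openF'[OF V] by (auto simp: openin_LVM[OF L] points_LVM[OF L])
  qed
  have opn: "open_map (cs_top (LVM L)) (cs_top (cs_fibre E fst L)) (Pair L)"
    unfolding open_map_def
  proof (intro allI impI)
    fix U assume "openin (cs_top (LVM L)) U"
    then have U: "U \<subseteq> ?q ` S" "open {z \<in> S. ?q z \<in> U}"
      by (auto simp: openin_LVM[OF L])
    \<comment> \<open>The same set of vectors is used over every configuration. Its image over other
      configurations may mean something else, but its trace on the fibre over \<open>L\<close> is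
      exactly the image of \<open>U\<close>.\<close>
    have "openin (cs_top E) (fam_proj ` (W \<times> {z \<in> S. ?q z \<in> U}))"
      using U(2) open_W by (intro openin_fam_proj open_Times) auto
    moreover have "Pair L ` U = fam_proj ` (W \<times> {z \<in> S. ?q z \<in> U}) \<inter> ?Y"
    proof (intro equalityI subsetI)
      fix x assume "x \<in> Pair L ` U"
      then obtain z where "z \<in> S" "?q z \<in> U" "x = fam_proj (L, z)"
        using U(1) q by auto
      then show "x \<in> fam_proj ` (W \<times> {z \<in> S. ?q z \<in> U}) \<inter> ?Y"
        using L by (auto simp: points_E)
    next
      fix x assume "x \<in> fam_proj ` (W \<times> {z \<in> S. ?q z \<in> U}) \<inter> ?Y"
      then obtain z where "z \<in> S" "?q z \<in> U" "x = fam_proj (L, z)"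
        by auto
      then show "x \<in> Pair L ` U"
        using q by auto
    qed
    ultimately show "openin (cs_top (cs_fibre E fst L)) (Pair L ` U)"
      unfolding topF openin_subtopology by blast
  qed
  have homeo: "homeomorphic_map (cs_top (LVM L)) (cs_top (cs_fibre E fst L)) (Pair L)"
    using cont opn
    by (rule bijective_open_imp_homeomorphic_map) (auto simp: pointsF Y points_LVM[OF L] inj_on_def)
  have hol: "cs_hol (cs_fibre E fst L) V f \<longleftrightarrow>
      (\<forall>z\<in>S. (L, ?q z) \<in> V \<longrightarrow> complex_diff (\<lambda>z. f (L, ?q z)) z)"
    if V: "openin (cs_top (cs_fibre E fst L)) V" for V and f :: "_ \<Rightarrow> complex"
  proof
    assume "cs_hol (cs_fibre E fst L) V f"
    then have ext: "\<forall>x\<in>V. \<exists>A g. openin (cs_top E) A \<and> x \<in> A \<and> cs_hol E A g \<and> (\<forall>y \<in> A \<inter> V. g y = f y)"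
      by (simp add: cs_fibre_def)
    show "\<forall>z\<in>S. (L, ?q z) \<in> V \<longrightarrow> complex_diff (\<lambda>z. f (L, ?q z)) z"
    proof (intro ballI impI)
      fix z assume z: "z \<in> S" "(L, ?q z) \<in> V"
      then obtain A g where A: "openin (cs_top E) A" "(L, ?q z) \<in> A" "cs_hol E A g"
        "\<And>y. y \<in> A \<inter> V \<Longrightarrow> g y = f y"
        using ext by meson
      have "complex_diff (g \<circ> fam_proj) (L, z)"
        using A(2,3) z(1) L by (simp add: hol_E q)
      then have "complex_diff (\<lambda>z. (g \<circ> fam_proj) (L, z)) z"
        by (intro complex_diff_compose[of "Pair L" z "g \<circ> fam_proj"] complex_diff_Pair) auto
      then show "complex_diff (\<lambda>z. f (L, ?q z)) z"
      proof (rule complex_diff_transform)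
        show "open ({z \<in> S. (L, ?q z) \<in> A} \<inter> {z \<in> S. (L, ?q z) \<in> V})"
          by (intro open_Int slice_open openF' A(1) V)
      qed (use z A(2,4) in \<open>auto simp: q\<close>)
    qed
  next
    assume f: "\<forall>z\<in>S. (L, ?q z) \<in> V \<longrightarrow> complex_diff (\<lambda>z. f (L, ?q z)) z"
    have "\<exists>A g. openin (cs_top E) A \<and> x \<in> A \<and> cs_hol E A g \<and> (\<forall>y \<in> A \<inter> V. g y = f y)" if x: "x \<in> V" for x
    proof -
      have xY: "x \<in> ?Y"
        using V x openin_subset pointsF by blast
      obtain A and B :: "(((complex ^ 'm) ^ 'n) \<times> (complex ^ 'd)) set" and \<phi> \<iota>
        where AB: "openin (cs_top E) A" "x \<in> A" "open B"
          "biholomorphic_map (cs_restrict E A) (open_cspace B) \<phi>"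
          "\<And>p. p \<in> B \<Longrightarrow> (fst p, \<iota> (snd p)) \<in> W \<times> S"
          "A = (\<lambda>p. fam_proj (fst p, \<iota> (snd p))) ` B"
          "\<And>p. p \<in> B \<Longrightarrow> \<phi> (fam_proj (fst p, \<iota> (snd p))) = p"
          "\<And>w. complex_diff \<iota> w"
        using ex_chart_at[OF d, of x] xY by blast
      \<comment> \<open>The part of the chart whose points, moved to base coordinate
        \<open>L\<close>, stay in the chart and land in \<open>V\<close>; there the extension
        \<open>h\<close> is defined by the value at the moved point.\<close>
      define B' where "B' = B \<inter> {p. (L, snd p) \<in> B \<and> (L, ?q (\<iota> (snd p))) \<in> V}"
      define h where "h p = f (L, ?q (\<iota> (snd p)))" for p :: "((complex ^ 'm) ^ 'n) \<times> (complex ^ 'd)"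
      have A_sub: "A \<subseteq> cs_points E"
        using AB(1) by (rule openin_subset)
      have "open B'"
      proof -
        have \<iota>: "isCont (\<lambda>p. \<iota> (snd p)) p" for p :: "((complex ^ 'm) ^ 'n) \<times> (complex ^ 'd)"
          by (intro complex_diff_imp_isCont complex_diff_compose[of snd p \<iota>] AB(8) complex_diff_snd complex_diff_ident)
        have "B' = B \<inter> (\<lambda>p. (L, snd p)) -` B \<inter> (\<lambda>p. \<iota> (snd p)) -` {z \<in> S. (L, ?q z) \<in> V}"
          using AB(5) by (force simp: B'_def)
        moreover have "open ((\<lambda>p::((complex ^ 'm) ^ 'n) \<times> (complex ^ 'd). (L, snd p)) -` B)"
          using AB(3) by (intro open_vimage continuous_intros)
        moreover have "open ((\<lambda>p::((complex ^ 'm) ^ 'n) \<times> (complex ^ 'd). \<iota> (snd p)) -` {z \<in> S. (L, ?q z) \<in> V})"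
          using openF'[OF V] \<iota> by (intro open_vimage continuous_at_imp_continuous_on) auto
        ultimately show ?thesis
          using AB(3) by auto
      qed
      have "holomorphic_several B' h"
        unfolding holomorphic_several_iff h_def
      proof
        fix p assume p: "p \<in> B'"
        then have "(L, \<iota> (snd p)) \<in> W \<times> S"
          using AB(5)[of "(L, snd p)"] by (auto simp: B'_def)
        then have "complex_diff (\<lambda>z. f (L, ?q z)) (\<iota> (snd p))"
          using f p by (auto simp: B'_def)
        moreover have "complex_diff (\<lambda>p. \<iota> (snd p)) p"
          by (intro complex_diff_compose[of snd p \<iota>] AB(8) complex_diff_snd complex_diff_ident)
        ultimately show "complex_diff (\<lambda>p. f (L, ?q (\<iota> (snd p)))) p"
          using complex_diff_compose[of "\<lambda>p. \<iota> (snd p)" p "\<lambda>z. f (L, ?q z)"] by blast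
      qed
      moreover have "openin (top_of_set B) B'"
        using \<open>open B'\<close> by (auto simp: openin_open_eq[OF AB(3)] B'_def)
      ultimately have holE: "cs_hol E {x \<in> A. \<phi> x \<in> B'} (h \<circ> \<phi>)"
        and contA: "openin (subtopology (cs_top E) A) {x \<in> A. \<phi> x \<in> B'}"
      proof -
        assume *: "holomorphic_several B' h" "openin (top_of_set B) B'"
        have pts: "cs_points (cs_restrict E A) = A"
          using A_sub by (auto simp: cs_restrict_def)
        have "cs_hol (open_cspace B) B' h \<longleftrightarrow> cs_hol (cs_restrict E A) {x \<in> A. \<phi> x \<in> B'} (h \<circ> \<phi>)"
          using AB(4) *(2) unfolding biholomorphic_map_def pts by (simp add: open_cspace_def)
        then show "cs_hol E {x \<in> A. \<phi> x \<in> B'} (h \<circ> \<phi>)"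
          using *(1) by (simp add: open_cspace_def cs_restrict_def)
        have "homeomorphic_map (cs_top (cs_restrict E A)) (top_of_set B) \<phi>"
          using AB(4) by (simp add: biholomorphic_map_def open_cspace_def)
        then have "continuous_map (cs_top (cs_restrict E A)) (top_of_set B) \<phi>"
          by (rule homeomorphic_imp_continuous_map)
        from openin_continuous_map_preimage[OF this *(2)] show "openin (subtopology (cs_top E) A) {x \<in> A. \<phi> x \<in> B'}"
          unfolding pts by (simp add: cs_restrict_def)
      qed
      have op: "openin (cs_top E) {x \<in> A. \<phi> x \<in> B'}"
        using contA openin_open_subtopology[OF AB(1)] by blast
      have fib: "y = (L, ?q (\<iota> (snd (\<phi> y)))) \<and> \<phi> y \<in> B \<and> (L, snd (\<phi> y)) \<in> B" if y: "y \<in> A" "fst y = L" for y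
      proof -
        obtain p where p: "p \<in> B" "y = fam_proj (fst p, \<iota> (snd p))"
          using y(1) AB(6) by auto
        then show ?thesis
          using y(2) AB(7)[OF p(1)] q by (cases p) auto
      qed
      have xL: "fst x = L"
        using xY by simp
      have "x \<in> {x \<in> A. \<phi> x \<in> B'}"
        using fib[OF AB(2) xL] x AB(2) by (simp add: B'_def)
      moreover have "(h \<circ> \<phi>) y = f y" if "y \<in> {x \<in> A. \<phi> x \<in> B'} \<inter> V" for y
      proof -
        have "fst y = L"
          using that V openin_subset pointsF by blast
        then have "y = (L, ?q (\<iota> (snd (\<phi> y))))"
          using fib[of y] that by blast
        then show ?thesis
          by (simp add: h_def)
      qed
      ultimately show ?thesis
        using op holE by blast
    qed
    then show "cs_hol (cs_fibre E fst L) V f"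
      by (simp add: cs_fibre_def)
  qed
  have "biholomorphic_map (LVM L) (cs_fibre E fst L) (Pair L)"
    unfolding biholomorphic_map_def
  proof (intro conjI allI impI homeo)
    fix V and f :: "_ \<Rightarrow> complex" assume V: "openin (cs_top (cs_fibre E fst L)) V"
    show "cs_hol (cs_fibre E fst L) V f \<longleftrightarrow>
        cs_hol (LVM L) {x \<in> cs_points (LVM L). (L, x) \<in> V} (f \<circ> Pair L)"
      unfolding hol[OF V] hol_LVM[OF L] by (auto simp: points_LVM[OF L])
  qed
  then show ?thesis
    unfolding biholomorphic_def by blast
qed

end

section \<open>Rational configurations satisfy condition (K)\<close>

text \<open>The range of the right inverse \<open>B\<close> is a complement of the kernel: every
  \<open>z\<close> is the sum of \<open>z - B *v (A *v z)\<close> and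
  \<open>B *v (A *v z)\<close>.\<close>

lemma dim_kernel_surjective:
  fixes A :: "'a::field ^ 'n ^ 'k"
  assumes "A ** B = mat 1"
  shows "vec.dim {x. A *v x = 0} = CARD('n) - CARD('k)"
proof -
  let ?K = "{x. A *v x = 0}" and ?R = "range ((*v) B)"
  have AB: "A *v (B *v y) = y" for y
    by (simp add: assms matrix_vector_mul_assoc)
  have subK: "vec.subspace ?K"
    by (auto simp: vec.subspace_def matrix_vector_right_distrib vector_scalar_commute)
  have linB: "Vector_Spaces.linear (*s) (*s) ((*v) B)"
    by (rule matrix_vector_mul_linear_gen)
  have subR: "vec.subspace ?R"
    by (rule vec.subspace_image[OF vec.subspace_UNIV])
  have "inj ((*v) B)"
    by (metis AB injI)
  then have dimR: "vec.dim ?R = CARD('k)"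
    using vec.dim_image_eq[OF linB, of UNIV] by (simp only: vec.span_UNIV vec_dim_card)
  have "x = 0" if "x \<in> ?K \<inter> ?R" for x
    using that AB by auto
  moreover have "0 \<in> ?K \<inter> ?R"
    using vec.subspace_0[OF subK] vec.subspace_0[OF subR] by blast
  ultimately have "?K \<inter> ?R = {0}"
    by blast
  then have dimKR: "vec.dim (?K \<inter> ?R) = 0"
    using vec.dim_le_card[of "?K \<inter> ?R" "{}"] by simp
  have sum: "{x + y |x y. x \<in> ?K \<and> y \<in> ?R} = UNIV"
  proof -
    have "z = (z - B *v (A *v z)) + B *v (A *v z)" for z
      by simp
    moreover have "z - B *v (A *v z) \<in> ?K" for z
      by (simp add: AB matrix_vector_mult_diff_distrib)
    ultimately show ?thesis
      by blast
  qed
  have "CARD('n) + 0 = vec.dim ?K + CARD('k)"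
    using vec.dim_sums_Int[OF subK subR] by (simp only: sum dimR dimKR vec_dim_card)
  then show ?thesis
    by simp
qed

lemma sum_Plus_UNIV:
  "(\<Sum>x\<in>(UNIV::('a::finite + 'b::finite) set). f x) = (\<Sum>x\<in>UNIV. f (Inl x)) + (\<Sum>x\<in>UNIV. f (Inr x))"
  unfolding UNIV_Plus_UNIV[symmetric] by (subst sum.Plus) auto

lemma (in lvm_domain) rational_condition_K:
  fixes a b :: "'n \<Rightarrow> 'm \<Rightarrow> rat"
  assumes L: "L \<in> W" and I: "UNIV \<in> \<I>"
    and ab: "\<And>i j. L $ i $ j = Complex (of_rat (a i j)) (of_rat (b i j))"
  shows "condition_K L"
proof -
  \<comment> \<open>Real parts, imaginary parts and the sum condition give 2m + 1 rows.\<close>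
  define A :: "rat ^ 'n ^ ('m + 'm) option" where
    "A = (\<chi> \<beta> i. case \<beta> of None \<Rightarrow> 1 | Some (Inl j) \<Rightarrow> a i j | Some (Inr j) \<Rightarrow> b i j)"
  have "rational_relations L = {s. A *v s = 0}"
  proof -
    have "(\<Sum>i\<in>UNIV. real_of_rat (s $ i) *\<^sub>R L $ i) = 0 \<and> (\<Sum>i\<in>UNIV. s $ i) = 0 \<longleftrightarrow> A *v s = 0" for s
    proof -
      have re: "Re ((\<Sum>i\<in>UNIV. real_of_rat (s $ i) *\<^sub>R L $ i) $ j) = of_rat ((A *v s) $ Some (Inl j))" for j
        by (simp add: ab A_def matrix_vector_mult_def of_rat_sum of_rat_mult mult.commute)
      have im: "Im ((\<Sum>i\<in>UNIV. real_of_rat (s $ i) *\<^sub>R L $ i) $ j) = of_rat ((A *v s) $ Some (Inr j))" for j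
        by (simp add: ab A_def matrix_vector_mult_def of_rat_sum of_rat_mult mult.commute)
      have none: "(\<Sum>i\<in>UNIV. s $ i) = (A *v s) $ None"
        by (simp add: A_def matrix_vector_mult_def)
      have "(\<Sum>i\<in>UNIV. real_of_rat (s $ i) *\<^sub>R L $ i) = 0 \<longleftrightarrow>
          (\<forall>j. (A *v s) $ Some (Inl j) = 0 \<and> (A *v s) $ Some (Inr j) = 0)"
        unfolding vec_eq_iff[where y = 0] complex_eq_iff re im by simp
      moreover have "A *v s = 0 \<longleftrightarrow> (A *v s) $ None = 0 \<and>
          (\<forall>j. (A *v s) $ Some (Inl j) = 0 \<and> (A *v s) $ Some (Inr j) = 0)"
      proof -
        have all: "(\<forall>\<beta>. P \<beta>) \<longleftrightarrow> P None \<and> (\<forall>j. P (Some (Inl j)) \<and> P (Some (Inr j)))"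
          for P :: "('m + 'm) option \<Rightarrow> bool"
          by (metis option.exhaust sum.exhaust)
        show ?thesis
          unfolding vec_eq_iff[where y = 0] all[of "\<lambda>\<beta>. (A *v s) $ \<beta> = 0 $ \<beta>"] by simp
      qed
      ultimately show ?thesis
        unfolding none by blast
    qed
    then show ?thesis
      by (simp add: rational_relations_def)
  qed
  moreover have "\<forall>c. (\<Sum>\<beta>\<in>UNIV. c \<beta> *s row \<beta> A) = 0 \<longrightarrow> (\<forall>\<beta>. c \<beta> = 0)"
  proof (intro allI impI)
    fix c \<beta> assume c: "(\<Sum>\<beta>\<in>UNIV. c \<beta> *s row \<beta> A) = 0"
    \<comment> \<open>The minus sign is chosen because Re ((a + i b) (c - i c')) = a c + b c'; a
      relation between the rows thus says that all real weights of \<open>T\<close> are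
      equal.\<close>
    define T :: "complex ^ 'm" where "T = (\<chi> j. Complex (of_rat (c (Some (Inl j)))) (- of_rat (c (Some (Inr j)))))"
    have "Re (weight L i T) + of_rat (c None) = 0" for i
    proof -
      have "(\<Sum>\<beta>\<in>UNIV. c \<beta> *s row \<beta> A) $ i = 0"
        using c by simp
      then have "c None + ((\<Sum>j\<in>UNIV. c (Some (Inl j)) * a i j) + (\<Sum>j\<in>UNIV. c (Some (Inr j)) * b i j)) = 0"
        by (simp add: sum_option sum_Plus_UNIV A_def row_def)
      then have "(of_rat (c None + ((\<Sum>j\<in>UNIV. c (Some (Inl j)) * a i j) + (\<Sum>j\<in>UNIV. c (Some (Inr j)) * b i j))) :: real) = 0"
        by simp
      moreover have "Re (weight L i T) = (\<Sum>j\<in>UNIV. of_rat (c (Some (Inl j)) * a i j)) + (\<Sum>j\<in>UNIV. of_rat (c (Some (Inr j)) * b i j))"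
        by (simp add: weight_def ab T_def of_rat_mult mult.commute flip: sum.distrib)
      ultimately show ?thesis
        by (simp add: of_rat_add of_rat_sum)
    qed
    from Re_weight_const_zero[OF L I this] have T0: "T = 0" and "c None = 0"
      by auto
    moreover have "c (Some (Inl j)) = 0 \<and> c (Some (Inr j)) = 0" for j
      using arg_cong[OF T0, of "\<lambda>T. T $ j"] by (simp add: T_def complex_eq_iff)
    ultimately show "c \<beta> = 0"
      by (metis option.exhaust sum.exhaust)
  qed
  then have "\<exists>B. A ** B = mat 1"
    by (rule iffD2[OF matrix_right_invertible_independent_rows])
  then obtain B where "A ** B = mat 1" ..
  then have "vec.dim {s. A *v s = 0} = CARD('n) - CARD(('m + 'm) option)"
    by (rule dim_kernel_surjective)
  ultimately show ?thesis
    by (simp add: condition_K_def)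
qed

lemma ex_rational_configuration:
  fixes \<Lambda> :: "(complex ^ 'm) ^ 'n"
  assumes "e > 0"
  obtains L and a b :: "'n \<Rightarrow> 'm \<Rightarrow> rat" where "dist \<Lambda> L < e"
    "\<And>i j. L $ i $ j = Complex (of_rat (a i j)) (of_rat (b i j))"
proof -
  \<comment> \<open>Each entry changes by at most 2d in norm, and there are n m entries, so the
    total change is at most e / 2.\<close>
  define d where "d = e / (4 * CARD('n) * CARD('m))"
  have "d > 0"
    using assms by (simp add: d_def)
  have "\<exists>q. \<bar>x - of_rat q\<bar> \<le> d" for x :: real
  proof -
    obtain q where "x < of_rat q" "of_rat q < x + d"
      using of_rat_dense[of x "x + d"] \<open>d > 0\<close> by auto
    then show ?thesis
      by (intro exI[of _ q]) (auto simp: abs_le_iff)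
  qed
  then obtain q :: "real \<Rightarrow> rat" where q: "\<And>x. \<bar>x - of_rat (q x)\<bar> \<le> d"
    by metis
  define L :: "(complex ^ 'm) ^ 'n" where
    "L = (\<chi> i j. Complex (of_rat (q (Re (\<Lambda> $ i $ j)))) (of_rat (q (Im (\<Lambda> $ i $ j)))))"
  have norm_sum: "norm (v :: 'b::real_normed_vector ^ 'c) \<le> (\<Sum>i\<in>UNIV. norm (v $ i))" for v
    unfolding norm_vec_def by (rule L2_set_le_sum) simp
  have entry: "norm ((\<Lambda> - L) $ i $ j) \<le> 2 * d" for i j
    using cmod_le[of "(\<Lambda> - L) $ i $ j"] q[of "Re (\<Lambda> $ i $ j)"] q[of "Im (\<Lambda> $ i $ j)"]
    by (simp add: L_def)
  have "norm ((\<Lambda> - L) $ i) \<le> (\<Sum>j\<in>(UNIV :: 'm set). 2 * d)" for i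
    using entry by (intro order_trans[OF norm_sum] sum_mono)
  then have "norm (\<Lambda> - L) \<le> (\<Sum>i\<in>(UNIV :: 'n set). \<Sum>j\<in>(UNIV :: 'm set). 2 * d)"
    by (intro order_trans[OF norm_sum[of "\<Lambda> - L"]] sum_mono)
  also have "\<dots> = e / 2"
    by (simp add: d_def)
  finally have "dist \<Lambda> L < e"
    using assms by (simp add: dist_norm)
  then show thesis
    by (rule that) (simp add: L_def)
qed

theorem corollary3:
  fixes \<Lambda> :: "(complex ^ 'm) ^ 'n"
  assumes "CARD('n) > 2 * CARD('m)"
    and "CARD('d::finite) = CARD('n) - CARD('m) - 1"
    and "admissible \<Lambda>"
  shows "\<forall>U. open U \<and> \<Lambda> \<in> U \<longrightarrow>
    (\<exists>W \<Lambda>' N X p.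
       open W \<and> connected W \<and> W \<subseteq> U \<and> \<Lambda> \<in> W \<and> \<Lambda>' \<in> W \<and>
       (\<forall>L\<in>W. admissible L) \<and>
       holomorphic_family TYPE('d) (LVM_family W) fst W \<and>
       (\<forall>L\<in>W. biholomorphic (LVM L) (cs_fibre (LVM_family W) fst L)) \<and>
       biholomorphic N (cs_fibre (LVM_family W) fst \<Lambda>') \<and>
       generalized_CE_fibration \<Lambda>' N X p)"
proof (intro allI impI; elim conjE)
  fix U :: "((complex ^ 'm) ^ 'n) set" assume "open U" "\<Lambda> \<in> U"
  then obtain e \<I> r where e: "e > 0" "ball \<Lambda> e \<subseteq> U" and dom: "lvm_domain (ball \<Lambda> e) \<I> r"
    and adm: "\<And>L. L \<in> ball \<Lambda> e \<Longrightarrow> admissible L"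
    using ex_lvm_domain[OF assms(1,3)] by metis
  interpret lvm_domain "ball \<Lambda> e" \<I> r
    by (rule dom)
  have center: "\<Lambda> \<in> ball \<Lambda> e"
    using e(1) by simp
  \<comment> \<open>This is the Siegel condition. It puts the all-ones vector into \<open>S\<close>,
    so no fibre is empty, and it lets the rational relations involve all indices.\<close>
  have I: "UNIV \<in> \<I>"
    using assms(3) hull_iff[OF center, of UNIV] by (simp add: admissible_def siegel_def)
  then have "(\<chi> i. 1) \<in> S"
    by (simp add: S_def)
  then have S: "S \<noteq> {}"
    by blast
  obtain \<Lambda>' and a b :: "'n \<Rightarrow> 'm \<Rightarrow> rat" where \<Lambda>': "dist \<Lambda> \<Lambda>' < e"
    "\<And>i j. \<Lambda>' $ i $ j = Complex (of_rat (a i j)) (of_rat (b i j))"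
    using ex_rational_configuration[OF e(1)] by metis
  then have \<Lambda>'_in: "\<Lambda>' \<in> ball \<Lambda> e"
    by simp
  have "generalized_CE_fibration \<Lambda>' (LVM \<Lambda>') (CE_leaf_space \<Lambda>') (CE_leaf \<Lambda>')"
    using adm[OF \<Lambda>'_in] rational_condition_K[OF \<Lambda>'_in I \<Lambda>'(2)]
    by (simp add: generalized_CE_fibration_def)
  moreover have "holomorphic_family TYPE('d) (LVM_family (ball \<Lambda> e)) fst (ball \<Lambda> e)"
    by (rule holomorphic_family_E[OF assms(2) S])
  moreover have "\<forall>L\<in>ball \<Lambda> e. biholomorphic (LVM L) (cs_fibre (LVM_family (ball \<Lambda> e)) fst L)"
    using biholomorphic_fibre[OF _ assms(2)] by blast
  ultimately have "open (ball \<Lambda> e)" "connected (ball \<Lambda> e)" "ball \<Lambda> e \<subseteq> U" "\<Lambda> \<in> ball \<Lambda> e" "\<Lambda>' \<in> ball \<Lambda> e"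
    "\<forall>L\<in>ball \<Lambda> e. admissible L" "holomorphic_family TYPE('d) (LVM_family (ball \<Lambda> e)) fst (ball \<Lambda> e)"
    "\<forall>L\<in>ball \<Lambda> e. biholomorphic (LVM L) (cs_fibre (LVM_family (ball \<Lambda> e)) fst L)"
    "biholomorphic (LVM \<Lambda>') (cs_fibre (LVM_family (ball \<Lambda> e)) fst \<Lambda>')"
    "generalized_CE_fibration \<Lambda>' (LVM \<Lambda>') (CE_leaf_space \<Lambda>') (CE_leaf \<Lambda>')"
    using \<Lambda>'_in center e(2) adm by (simp_all only: open_ball connected_ball) blast+
  then show "\<exists>W \<Lambda>' N X p.
       open W \<and> connected W \<and> W \<subseteq> U \<and> \<Lambda> \<in> W \<and> \<Lambda>' \<in> W \<and>
       (\<forall>L\<in>W. admissible L) \<and>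
       holomorphic_family TYPE('d) (LVM_family W) fst W \<and>
       (\<forall>L\<in>W. biholomorphic (LVM L) (cs_fibre (LVM_family W) fst L)) \<and>
       biholomorphic N (cs_fibre (LVM_family W) fst \<Lambda>') \<and>
       generalized_CE_fibration \<Lambda>' N X p"
    by (intro exI conjI)
qed

end
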